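(* Let $G$ be the simply connected $2$-step nilpotent Lie group whose Lie algebra is $\mathcal{G}=V\oplus V'$ as defined in the context, and identify $G/[G,G]$ with the vector space $V$. If $\tau\in\mathrm{Aut}(G)$ and the factor $\overline\tau$ of $\tau$ on $V=G/[G,G]$ has determinant $1$, then $\overline\tau$ has a nonzero fixed point in $V$. Consequently, if $\Gamma$ is a lattice (a discrete cocompact subgroup) in $G$ and $\tau\in\mathrm{Aut}(G)$ is such that $\tau(\Gamma)=\Gamma$, then the factor automorphism $\pi(\tau):G/\Gamma\to G/\Gamma$ is not an Anosov automorphism, and furthermore it is not ergodic.
   Context: $V$ is a $5$-dimensional real vector space with basis $\sigma_1,\dots,\sigma_5$; $W\subset\wedge^2V$ is the subspace spanned by $\sigma_1\wedge\sigma_4-\sigma_2\wedge\sigma_3$, $\sigma_1\wedge\sigma_5-\sigma_2\wedge\sigma_4$, $\sigma_2\wedge\sigma_5-\sigma_3\wedge\sigma_4$; $V'=(\wedge^2V)/W$; and $\mathcal{G}=V\oplus V'$ carries the Lie bracket determined by $[v_1,v_2]=v_1\wedge v_2\bmod W$ for $v_1,v_2\in V$ and $[x,y]=0$ for $x\in\mathcal{G}$, $y\in V'$. $\mathrm{Aut}(G)$ is the group of continuous automorphisms of $G$. For $\tau\in \mathrm{Aut}(G)$ with $\tau(\Gamma)=\Gamma$, $\pi(\tau)$ is the map $g\Gamma\mapsto\tau(g)\Gamma$. It is an Anosov automorphism if the derivative of $\tau$ on $\mathcal{G}$ is hyperbolic (has no eigenvalue of absolute value $1$). Ergodicity is with respect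 to the $G$-invariant probability measure on $G/\Gamma$. *)

theory Defs
  imports "HOL-Analysis.Analysis" "HOL-Probability.Probability_Measure" "HOL-Algebra.Left_Coset" "HOL-Algebra.Generated_Groups"
begin

section \<open>The exterior square of V and the subspace W\<close>

abbreviation \<sigma> :: "5 \<Rightarrow> real^5" where "\<sigma> i \<equiv> axis i 1"

text \<open>The exterior square of \<open>V = real^5\<close> is realised by skew-symmetric tensors; the entry of
  \<open>v \<and> w\<close> at \<open>(i, j)\<close> with \<open>i < j\<close> is its coordinate with respect to \<open>\<sigma> i \<and> \<sigma> j\<close>.\<close>

definition wedge :: "real^5 \<Rightarrow> real^5 \<Rightarrow> real^5^5" (infixl "\<^bold>\<and>" 75) where
  "v \<^bold>\<and> w = (\<chi> i j. v $ i * w $ j - v $ j * w $ i)"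

definition Wedge2 :: "(real^5^5) set" where
  "Wedge2 = span {v \<^bold>\<and> w | v w. True}"

definition w1 :: "real^5^5" where "w1 = \<sigma> 1 \<^bold>\<and> \<sigma> 4 - \<sigma> 2 \<^bold>\<and> \<sigma> 3"
definition w2 :: "real^5^5" where "w2 = \<sigma> 1 \<^bold>\<and> \<sigma> 5 - \<sigma> 2 \<^bold>\<and> \<sigma> 4"
definition w3 :: "real^5^5" where "w3 = \<sigma> 2 \<^bold>\<and> \<sigma> 5 - \<sigma> 3 \<^bold>\<and> \<sigma> 4"

definition W :: "(real^5^5) set" where "W = span {w1, w2, w3}"

lemma wedge_\<sigma>_nth:
  "(\<sigma> i \<^bold>\<and> \<sigma> j) $ k $ l = (if i = k then if j = l then 1 else 0 else 0)
     - (if i = l then if j = k then 1 else 0 else 0)"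
  by (simp add: wedge_def axis_def)

lemma sum_wedge_\<sigma>:
  "(\<Sum>i\<in>UNIV. \<Sum>j\<in>UNIV. f i j * (\<sigma> k \<^bold>\<and> \<sigma> l) $ i $ j) = f k l - f l k"
proof -
  have "f i j * (\<sigma> k \<^bold>\<and> \<sigma> l) $ i $ j
    = (if j = l then if i = k then f i j else 0 else 0)
      - (if j = k then if i = l then f i j else 0 else 0)" for i j
    unfolding wedge_\<sigma>_nth by auto
  then show ?thesis
    by (simp only: sum_subtractf sum.delta finite UNIV_I if_True)
qed

lemma inner_wedge_\<sigma>: "A \<bullet> (\<sigma> i \<^bold>\<and> \<sigma> j) = A $ i $ j - A $ j $ i"
  unfolding inner_vec_def inner_real_def by (rule sum_wedge_\<sigma>)

lemma wedge_\<sigma>_nth_swap: "(\<sigma> i \<^bold>\<and> \<sigma> j) $ k $ l = (\<sigma> k \<^bold>\<and> \<sigma> l) $ i $ j"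
  unfolding wedge_\<sigma>_nth by auto

lemma neq_5 [simp]:
  "(1::5) \<noteq> 2" "(1::5) \<noteq> 3" "(1::5) \<noteq> 4" "(1::5) \<noteq> 5"
  "(2::5) \<noteq> 1" "(2::5) \<noteq> 3" "(2::5) \<noteq> 4" "(2::5) \<noteq> 5"
  "(3::5) \<noteq> 1" "(3::5) \<noteq> 2" "(3::5) \<noteq> 4" "(3::5) \<noteq> 5"
  "(4::5) \<noteq> 1" "(4::5) \<noteq> 2" "(4::5) \<noteq> 3" "(4::5) \<noteq> 5"
  "(5::5) \<noteq> 1" "(5::5) \<noteq> 2" "(5::5) \<noteq> 3" "(5::5) \<noteq> 4"
  by simp_all

lemma subspace_Wedge2: "subspace Wedge2"
  unfolding Wedge2_def by (rule subspace_span)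

lemma wedge_in_Wedge2 [simp]: "v \<^bold>\<and> w \<in> Wedge2"
  unfolding Wedge2_def by (rule span_base) (intro CollectI exI[of _ v] exI[of _ w] conjI refl TrueI)

lemma Wedge2_eq: "Wedge2 = {A. transpose A = - A}"
proof
  have "subspace {A::real^5^5. transpose A = - A}"
  proof (rule subspaceI)
    show "0 \<in> {A::real^5^5. transpose A = - A}"
      by (simp add: transpose_def vec_eq_iff)
  next
    fix A B :: "real^5^5"
    have "transpose (A + B) = transpose A + transpose B"
      by (simp add: transpose_def vec_eq_iff)
    then show "A \<in> {A. transpose A = - A} \<Longrightarrow> B \<in> {A. transpose A = - A}
        \<Longrightarrow> A + B \<in> {A. transpose A = - A}"
      by simp
  next
    fix A :: "real^5^5" and c
    have "transpose (c *\<^sub>R A) = c *\<^sub>R transpose A"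
      by (simp add: transpose_def vec_eq_iff)
    then show "A \<in> {A. transpose A = - A} \<Longrightarrow> c *\<^sub>R A \<in> {A. transpose A = - A}"
      by simp
  qed
  moreover have "transpose (v \<^bold>\<and> w) = - (v \<^bold>\<and> w)" for v w
    by (simp add: wedge_def transpose_def vec_eq_iff)
  then have "{v \<^bold>\<and> w | v w. True} \<subseteq> {A. transpose A = - A}"
    by (auto simp only: subset_iff mem_Collect_eq)
  ultimately show "Wedge2 \<subseteq> {A. transpose A = - A}"
    unfolding Wedge2_def by (rule span_minimal[rotated])
next
  show "{A. transpose A = - A} \<subseteq> Wedge2"
  proof
    fix A :: "real^5^5" assume t: "A \<in> {A. transpose A = - A}"
    have A: "A $ j $ i = - A $ i $ j" for i j
    proof -
      have "transpose A $ i $ j = (- A) $ i $ j" using t by simp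
      then show ?thesis by (simp only: transpose_def vec_lambda_beta vector_uminus_component)
    qed
    have "(\<Sum>i\<in>UNIV. \<Sum>j\<in>UNIV. (A $ i $ j / 2) * (\<sigma> i \<^bold>\<and> \<sigma> j) $ k $ l) = A $ k $ l" for k l
    proof -
      have "(\<Sum>i\<in>UNIV. \<Sum>j\<in>UNIV. (A $ i $ j / 2) * (\<sigma> i \<^bold>\<and> \<sigma> j) $ k $ l)
          = A $ k $ l / 2 - A $ l $ k / 2"
        unfolding wedge_\<sigma>_nth_swap[of _ _ k l] by (rule sum_wedge_\<sigma>)
      then show ?thesis by (simp add: A[of k l])
    qed
    then have "A = (\<Sum>i\<in>UNIV. \<Sum>j\<in>UNIV. (A $ i $ j / 2) *\<^sub>R (\<sigma> i \<^bold>\<and> \<sigma> j))"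
      by (simp add: vec_eq_iff)
    also have "\<dots> \<in> Wedge2"
      by (intro subspace_sum subspace_scale subspace_Wedge2) simp
    finally show "A \<in> Wedge2" .
  qed
qed

lemma subspace_W: "subspace W"
  unfolding W_def by (rule subspace_span)

lemma W_subset: "W \<subseteq> Wedge2"
proof -
  have "w1 \<in> Wedge2" "w2 \<in> Wedge2" "w3 \<in> Wedge2"
    unfolding w1_def w2_def w3_def by (intro subspace_diff[OF subspace_Wedge2] wedge_in_Wedge2)+
  then show ?thesis
    unfolding W_def by (intro span_minimal subspace_Wedge2) simp
qed


section \<open>The quotient \<open>V' = Wedge2 / W\<close>\<close>

definition Wrel :: "real^5^5 \<Rightarrow> real^5^5 \<Rightarrow> bool" where
  "Wrel A B \<longleftrightarrow> A \<in> Wedge2 \<and> B \<in> Wedge2 \<and> A - B \<in> W"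

lemma Wrel_refl: "Wrel A A \<longleftrightarrow> A \<in> Wedge2"
  by (simp add: Wrel_def subspace_0[OF subspace_W])

lemma part_equivp_Wrel: "part_equivp Wrel"
proof (rule part_equivpI)
  show "\<exists>x. Wrel x x"
    using subspace_0[OF subspace_Wedge2] Wrel_refl by blast
  show "symp Wrel"
  proof (rule sympI)
    fix A B assume "Wrel A B"
    then show "Wrel B A"
      using subspace_neg[OF subspace_W, of "A - B"] by (simp add: Wrel_def)
  qed
  show "transp Wrel"
  proof (rule transpI)
    fix A B C assume "Wrel A B" "Wrel B C"
    then show "Wrel A C"
      using subspace_add[OF subspace_W, of "A - B" "B - C"] by (simp add: Wrel_def)
  qed
qed

lemma Wrel_add: "Wrel A B \<Longrightarrow> Wrel C D \<Longrightarrow> Wrel (A + C) (B + D)"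
  using subspace_add[OF subspace_W, of "A - B" "C - D"] subspace_add[OF subspace_Wedge2]
  by (simp add: Wrel_def algebra_simps)

lemma Wrel_scaleR: "Wrel A B \<Longrightarrow> Wrel (c *\<^sub>R A) (c *\<^sub>R B)"
  using subspace_scale[OF subspace_W, of "A - B" c] subspace_scale[OF subspace_Wedge2]
  by (simp add: Wrel_def scaleR_diff_right)

lemma Wrel_uminus: "Wrel A B \<Longrightarrow> Wrel (- A) (- B)"
  using Wrel_scaleR[of A B "-1"] by simp

quotient_type V' = "real^5^5" / partial: Wrel
  morphisms rep_V' modW
  by (rule part_equivp_Wrel)

instantiation V' :: real_vector
begin

lift_definition zero_V' :: V' is 0
  by (simp add: Wrel_refl subspace_0[OF subspace_Wedge2])

lift_definition plus_V' :: "V' \<Rightarrow> V' \<Rightarrow> V'" is "(+)"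
  by (rule Wrel_add)

lift_definition uminus_V' :: "V' \<Rightarrow> V'" is uminus
  by (rule Wrel_uminus)

lift_definition scaleR_V' :: "real \<Rightarrow> V' \<Rightarrow> V'" is "(*\<^sub>R)"
  by (rule Wrel_scaleR)

definition minus_V' :: "V' \<Rightarrow> V' \<Rightarrow> V'" where "minus_V' x y = x + (- y)"

instance
proof
  fix x y z :: V' and a b :: real
  note S = Wrel_refl subspace_add[OF subspace_Wedge2]
    subspace_scale[OF subspace_Wedge2] subspace_neg[OF subspace_Wedge2] subspace_0[OF subspace_Wedge2]
  show "x + y + z = x + (y + z)"
    by transfer (simp add: S algebra_simps)
  show "x + y = y + x"
    by transfer (simp add: S algebra_simps)
  show "0 + x = x"
    by transfer (simp add: S algebra_simps)
  show "- x + x = 0"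
    by transfer (simp add: S algebra_simps)
  show "x - y = x + (- y)"
    by (simp add: minus_V'_def)
  show "a *\<^sub>R (x + y) = a *\<^sub>R x + a *\<^sub>R y"
    by transfer (simp add: S algebra_simps)
  show "(a + b) *\<^sub>R x = a *\<^sub>R x + b *\<^sub>R x"
    by transfer (simp add: S algebra_simps)
  show "a *\<^sub>R b *\<^sub>R x = (a * b) *\<^sub>R x"
    by transfer (simp add: S algebra_simps)
  show "1 *\<^sub>R x = x"
    by transfer (simp add: S algebra_simps)
qed

end

lemma modW_add: "A \<in> Wedge2 \<Longrightarrow> B \<in> Wedge2 \<Longrightarrow> modW (A + B) = modW A + modW B"
  by (simp add: plus_V'.abs_eq Wrel_refl)

lemma modW_scaleR: "A \<in> Wedge2 \<Longrightarrow> modW (a *\<^sub>R A) = a *\<^sub>R modW A"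
  by (simp add: scaleR_V'.abs_eq Wrel_refl)

lemma modW_eq_iff: "A \<in> Wedge2 \<Longrightarrow> B \<in> Wedge2 \<Longrightarrow> modW A = modW B \<longleftrightarrow> A - B \<in> W"
  using Quotient3_rel[OF Quotient3_V', of A B] by (simp add: Wrel_refl) (simp add: Wrel_def)

lemma modW_0: "modW 0 = 0"
  by (simp add: zero_V'_def)

lemma modW_surj: "\<exists>A\<in>Wedge2. x = modW A"
  using Quotient3_abs_rep[OF Quotient3_V', of x] Quotient3_rep_reflp[OF Quotient3_V', of x]
  by (intro bexI[of _ "rep_V' x"]) (simp_all add: Wrel_refl)

text \<open>The Euclidean structure on \<open>V'\<close> only serves to fix the canonical topology of this
  finite-dimensional space: the quotient is identified with the orthogonal complement of
  \<open>W\<close> in \<open>Wedge2\<close>.\<close>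

definition projW :: "real^5^5 \<Rightarrow> real^5^5" where
  "projW A = A - (A \<bullet> w1 / 4) *\<^sub>R w1 - (A \<bullet> w2 / 4) *\<^sub>R w2 - (A \<bullet> w3 / 4) *\<^sub>R w3"

lemma w_inner:
  "w1 \<bullet> w1 = 4" "w2 \<bullet> w2 = 4" "w3 \<bullet> w3 = 4"
  "w1 \<bullet> w2 = 0" "w2 \<bullet> w1 = 0" "w1 \<bullet> w3 = 0" "w3 \<bullet> w1 = 0" "w2 \<bullet> w3 = 0" "w3 \<bullet> w2 = 0"
  by (simp_all add: w1_def w2_def w3_def inner_diff_right inner_wedge_\<sigma> wedge_\<sigma>_nth)

lemma linear_projW: "linear projW"
  unfolding projW_def
  by (rule linearI) (simp_all add: inner_add_left algebra_simps add_divide_distrib)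

lemma projW_W: "A \<in> W \<Longrightarrow> projW A = 0"
proof -
  assume "A \<in> W"
  moreover have "subspace {A. projW A = 0}" by (rule linear_subspace_kernel[OF linear_projW])
  moreover have "{w1, w2, w3} \<subseteq> {A. projW A = 0}" by (auto simp: projW_def w_inner)
  ultimately show "projW A = 0" unfolding W_def using span_minimal by blast
qed

lemma projW_diff_in: "A - projW A \<in> W"
proof -
  have "w1 \<in> W" "w2 \<in> W" "w3 \<in> W" by (auto simp: W_def span_base)
  moreover have "A - projW A = (A \<bullet> w1 / 4) *\<^sub>R w1 + (A \<bullet> w2 / 4) *\<^sub>R w2 + (A \<bullet> w3 / 4) *\<^sub>R w3"
    by (simp add: projW_def)
  ultimately show ?thesis
    by (auto intro!: subspace_add subspace_scale subspace_W)
qed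

lemma projW_0_iff: "projW A = 0 \<longleftrightarrow> A \<in> W"
  using projW_W projW_diff_in[of A] by auto

lemma projW_perp: "projW A \<bullet> w1 = 0" "projW A \<bullet> w2 = 0" "projW A \<bullet> w3 = 0"
  by (simp_all add: projW_def inner_diff_left w_inner)

lemma projW_cong: "Wrel A B \<Longrightarrow> projW A = projW B"
  using projW_W[of "A - B"] by (simp add: Wrel_def linear_diff[OF linear_projW])

lemma projW_fixed: "A \<bullet> w1 = 0 \<Longrightarrow> A \<bullet> w2 = 0 \<Longrightarrow> A \<bullet> w3 = 0 \<Longrightarrow> projW A = A"
  by (simp add: projW_def)

lemma projW_Wedge2: "A \<in> Wedge2 \<Longrightarrow> projW A \<in> Wedge2"
  using projW_diff_in[of A] W_subset subspace_diff[OF subspace_Wedge2, of A "A - projW A"] by auto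

definition Wperp :: "(real^5^5) set" where
  "Wperp = {A \<in> Wedge2. A \<bullet> w1 = 0 \<and> A \<bullet> w2 = 0 \<and> A \<bullet> w3 = 0}"

definition Wperp_basis :: "(real^5^5) set" where
  "Wperp_basis = (SOME B. B \<subseteq> Wperp \<and> pairwise orthogonal B \<and> (\<forall>x\<in>B. norm x = 1) \<and>
     finite B \<and> span B = Wperp)"

lemma Wperp_basis:
  "Wperp_basis \<subseteq> Wperp" "pairwise orthogonal Wperp_basis" "\<forall>x\<in>Wperp_basis. norm x = 1"
  "finite Wperp_basis" "span Wperp_basis = Wperp"
proof -
  have "subspace Wperp"
    using subspace_Wedge2 by (auto simp: Wperp_def subspace_def inner_add_left)
  then obtain B where "B \<subseteq> Wperp" "pairwise orthogonal B" "\<And>x. x \<in> B \<Longrightarrow> norm x = 1"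
    "independent B" "span B = Wperp"
    using orthonormal_basis_subspace by metis
  then have "\<exists>B. B \<subseteq> Wperp \<and> pairwise orthogonal B \<and> (\<forall>x\<in>B. norm x = 1) \<and> finite B \<and> span B = Wperp"
    using independent_imp_finite by blast
  from someI_ex[OF this]
  show "Wperp_basis \<subseteq> Wperp" "pairwise orthogonal Wperp_basis" "\<forall>x\<in>Wperp_basis. norm x = 1"
    "finite Wperp_basis" "span Wperp_basis = Wperp"
    unfolding Wperp_basis_def by blast+
qed

instantiation V' :: euclidean_space
begin

lift_definition inner_V' :: "V' \<Rightarrow> V' \<Rightarrow> real" is "\<lambda>A B. projW A \<bullet> projW B"
  using projW_cong by simp

definition norm_V' :: "V' \<Rightarrow> real" where "norm_V' x = sqrt (x \<bullet> x)"
definition sgn_V' :: "V' \<Rightarrow> V'" where "sgn_V' x = x /\<^sub>R norm x"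
definition dist_V' :: "V' \<Rightarrow> V' \<Rightarrow> real" where "dist_V' x y = norm (x - y)"
definition uniformity_V' :: "(V' \<times> V') filter" where
  "uniformity_V' = (INF e\<in>{0 <..}. principal {(x, y). dist x y < e})"
definition open_V' :: "V' set \<Rightarrow> bool" where
  "open_V' U \<longleftrightarrow> (\<forall>x\<in>U. eventually (\<lambda>(x', y). x' = x \<longrightarrow> y \<in> U) uniformity)"
definition Basis_V' :: "V' set" where "Basis_V' = modW ` Wperp_basis"

lemma inner_modW: "A \<in> Wedge2 \<Longrightarrow> B \<in> Wedge2 \<Longrightarrow> modW A \<bullet> modW B = projW A \<bullet> projW B"
  by (simp add: inner_V'.abs_eq Wrel_refl)

instance
proof
  fix x y z :: V' and r :: real
  show "sgn x = x /\<^sub>R norm x" by (simp add: sgn_V'_def)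
  show "dist x y = norm (x - y)" by (simp add: dist_V'_def)
  show "(uniformity :: (V' \<times> V') filter) = (INF e\<in>{0 <..}. principal {(x, y). dist x y < e})"
    by (simp add: uniformity_V'_def)
  show "open U \<longleftrightarrow> (\<forall>x\<in>U. eventually (\<lambda>(x', y). x' = x \<longrightarrow> y \<in> U) uniformity)" for U :: "V' set"
    by (simp add: open_V'_def)
  show "norm x = sqrt (x \<bullet> x)" by (simp add: norm_V'_def)
  show "x \<bullet> y = y \<bullet> x" by transfer (simp add: inner_commute)
  show "(x + y) \<bullet> z = x \<bullet> z + y \<bullet> z"
    by transfer (simp add: linear_add[OF linear_projW] inner_add_left)
  show "(r *\<^sub>R x) \<bullet> y = r * (x \<bullet> y)"
    by transfer (simp add: linear_scale[OF linear_projW])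
  show "0 \<le> x \<bullet> x" by transfer simp
  show "x \<bullet> x = 0 \<longleftrightarrow> x = 0"
    by transfer (auto simp: projW_0_iff Wrel_def subspace_0 subspace_Wedge2)
  have mem: "A \<in> Wedge2" "projW A = A" if "A \<in> Wperp_basis" for A
    using Wperp_basis(1) that projW_fixed unfolding Wperp_def by auto
  have ne: "\<sigma> 1 \<^bold>\<and> \<sigma> 2 \<in> Wperp"
    by (simp add: Wperp_def w1_def w2_def w3_def inner_diff_right inner_wedge_\<sigma> wedge_\<sigma>_nth)
  have "(\<sigma> 1 \<^bold>\<and> \<sigma> 2) $ 1 $ 2 = 1" by (simp add: wedge_\<sigma>_nth)
  then have "\<sigma> 1 \<^bold>\<and> \<sigma> 2 \<noteq> 0" by force
  then show "(Basis :: V' set) \<noteq> {}"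
    using ne Wperp_basis(5) by (auto simp: Basis_V'_def)
  show "finite (Basis :: V' set)"
    using Wperp_basis(4) by (simp add: Basis_V'_def)
  show "u \<bullet> v = (if u = v then 1 else 0)" if uv: "u \<in> Basis" "v \<in> Basis" for u v :: V'
  proof -
    obtain A B where AB: "u = modW A" "v = modW B" "A \<in> Wperp_basis" "B \<in> Wperp_basis"
      using uv by (auto simp: Basis_V'_def)
    have i: "u \<bullet> v = A \<bullet> B" using AB mem by (simp add: inner_modW)
    have one: "A \<bullet> A = 1" using AB Wperp_basis(3) by (simp add: norm_eq_1)
    show ?thesis
    proof (cases "A = B")
      case True then show ?thesis using i one AB by simp
    next
      case False
      then have o: "A \<bullet> B = 0"
        using AB Wperp_basis(2) by (auto simp: pairwise_def orthogonal_def)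
      have "u \<bullet> u = 1" using one AB mem by (simp add: inner_modW)
      then have "u \<noteq> v" using i o by auto
      then show ?thesis using i o by simp
    qed
  qed
  show "(\<forall>u\<in>Basis. x \<bullet> u = 0) \<longleftrightarrow> x = 0"
  proof
    assume h: "\<forall>u\<in>Basis. x \<bullet> u = 0"
    obtain A where A: "A \<in> Wedge2" "x = modW A" using modW_surj by blast
    have "projW A \<bullet> B = 0" if "B \<in> Wperp_basis" for B
      using h that A mem[OF that] by (auto simp: Basis_V'_def inner_modW)
    then have "orthogonal (projW A) B" if "B \<in> span Wperp_basis" for B
      using that orthogonal_to_span[of B Wperp_basis "projW A"] by (auto simp: orthogonal_def)
    moreover have "projW A \<in> span Wperp_basis"
      using A projW_Wedge2 projW_perp Wperp_basis(5) by (auto simp: Wperp_def)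
    ultimately have "projW A = 0" by (metis inner_eq_zero_iff orthogonal_def)
    then show "x = 0"
      using A modW_eq_iff[of A 0] by (simp add: projW_0_iff modW_0 subspace_0 subspace_Wedge2)
  next
    assume "x = 0"
    then show "\<forall>u\<in>Basis. x \<bullet> u = 0"
    proof (clarify)
      fix u :: V'
      show "0 \<bullet> u = 0" by transfer (simp add: linear_0[OF linear_projW])
    qed
  qed
qed

end



section \<open>The Lie algebra and the Lie group\<close>

type_synonym lie = "(real^5) \<times> V'"

definition bracket :: "lie \<Rightarrow> lie \<Rightarrow> lie" where
  "bracket x y = (0, modW (fst x \<^bold>\<and> fst y))"

text \<open>The simply connected Lie group with this Lie algebra in exponential coordinates: the
  underlying manifold is the Lie algebra itself, and by 2-step nilpotency the
  Baker-Campbell-Hausdorff product reduces to \<open>x + y + [x, y] / 2\<close>.  In these coordinates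
  the exponential map is the identity and the neutral element is \<open>0\<close>.\<close>

definition nilG :: "lie monoid" where
  "nilG = \<lparr>carrier = UNIV, mult = (\<lambda>x y. x + y + (1/2) *\<^sub>R bracket x y), one = 0\<rparr>"

lemma nilG_simps [simp]:
  "carrier nilG = UNIV" "x \<otimes>\<^bsub>nilG\<^esub> y = x + y + (1/2) *\<^sub>R bracket x y" "\<one>\<^bsub>nilG\<^esub> = 0"
  by (simp_all add: nilG_def)

lemma wedge_add: "(u + v) \<^bold>\<and> w = u \<^bold>\<and> w + v \<^bold>\<and> w" "u \<^bold>\<and> (v + w) = u \<^bold>\<and> v + u \<^bold>\<and> w"
  by (simp_all add: wedge_def vec_eq_iff algebra_simps)

lemma wedge_scaleR: "(c *\<^sub>R v) \<^bold>\<and> w = c *\<^sub>R (v \<^bold>\<and> w)" "v \<^bold>\<and> (c *\<^sub>R w) = c *\<^sub>R (v \<^bold>\<and> w)"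
  by (simp_all add: wedge_def vec_eq_iff algebra_simps)

lemma wedge_0 [simp]: "0 \<^bold>\<and> w = 0" "v \<^bold>\<and> 0 = 0"
  by (simp_all add: wedge_def vec_eq_iff)

lemma wedge_self [simp]: "v \<^bold>\<and> v = 0"
  by (simp add: wedge_def vec_eq_iff)

lemma wedge_swap: "w \<^bold>\<and> v = (-1) *\<^sub>R (v \<^bold>\<and> w)"
  by (simp add: wedge_def vec_eq_iff)

lemma bracket_add: "bracket (x + y) z = bracket x z + bracket y z"
  "bracket x (y + z) = bracket x y + bracket x z"
  by (simp_all add: bracket_def wedge_add modW_add)

lemma bracket_scaleR: "bracket (c *\<^sub>R x) y = c *\<^sub>R bracket x y"
  "bracket x (c *\<^sub>R y) = c *\<^sub>R bracket x y"
  by (simp_all add: bracket_def wedge_scaleR modW_scaleR)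

lemma bracket_uminus: "bracket (- x) y = - bracket x y" "bracket x (- y) = - bracket x y"
  using bracket_scaleR(1)[of "-1" x y] bracket_scaleR(2)[of x "-1" y] by simp_all

lemma bracket_diff: "bracket (x - y) z = bracket x z - bracket y z"
  "bracket x (y - z) = bracket x y - bracket x z"
  using bracket_add(1)[of x "- y" z] bracket_add(2)[of x y "- z"] by (simp_all add: bracket_uminus)

lemma bracket_swap: "bracket y x = - bracket x y"
proof -
  have "modW (fst y \<^bold>\<and> fst x) = - modW (fst x \<^bold>\<and> fst y)"
    using modW_scaleR[of "fst x \<^bold>\<and> fst y" "-1"] wedge_swap[of "fst y" "fst x"] by simp
  then show ?thesis by (simp add: bracket_def)
qed

lemma bracket_self [simp]: "bracket x x = 0"
  by (simp add: bracket_def modW_0 zero_prod_def)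

lemma bracket_central: "fst x = 0 \<Longrightarrow> bracket x y = 0" "fst y = 0 \<Longrightarrow> bracket x y = 0"
  by (simp_all add: bracket_def modW_0 zero_prod_def)

lemma fst_bracket [simp]: "fst (bracket x y) = 0"
  by (simp add: bracket_def)

lemma bracket_bracket [simp]: "bracket (bracket x y) z = 0" "bracket x (bracket y z) = 0"
  by (simp_all add: bracket_central)

lemma bracket_zero [simp]: "bracket 0 x = 0" "bracket x 0 = 0"
  by (simp_all add: bracket_central)

lemma group_nilG: "group nilG"
proof (rule groupI)
  fix x y z
  show "x \<otimes>\<^bsub>nilG\<^esub> y \<otimes>\<^bsub>nilG\<^esub> z = x \<otimes>\<^bsub>nilG\<^esub> (y \<otimes>\<^bsub>nilG\<^esub> z)"
    by (simp add: bracket_add bracket_scaleR algebra_simps)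
  show "\<exists>y\<in>carrier nilG. y \<otimes>\<^bsub>nilG\<^esub> x = \<one>\<^bsub>nilG\<^esub>"
    by (intro bexI[of _ "- x"]) (simp_all add: bracket_uminus)
qed simp_all

interpretation nilG: group nilG
  by (rule group_nilG)

lemma inv_nilG: "inv\<^bsub>nilG\<^esub> x = - x"
  by (rule nilG.inv_equality) (simp_all add: bracket_uminus)

lemma commutator_nilG:
  "x \<otimes>\<^bsub>nilG\<^esub> y \<otimes>\<^bsub>nilG\<^esub> inv\<^bsub>nilG\<^esub> x \<otimes>\<^bsub>nilG\<^esub> inv\<^bsub>nilG\<^esub> y = bracket x y"
proof -
  have h: "(1/2) *\<^sub>R b + (1/2) *\<^sub>R b = b" for b :: lie
    by (simp flip: scaleR_add_left)
  have 1: "x \<otimes>\<^bsub>nilG\<^esub> y \<otimes>\<^bsub>nilG\<^esub> inv\<^bsub>nilG\<^esub> x = y + bracket x y"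
    using h[of "bracket x y"]
    by (simp add: inv_nilG bracket_add bracket_diff bracket_scaleR bracket_uminus bracket_swap[of x y])
  show ?thesis
    unfolding 1 by (simp add: inv_nilG bracket_add bracket_uminus)
qed

text \<open>The commutator subgroup is \<open>0 \<times> V'\<close>, so \<open>fst\<close> is the projection of the group onto
  its abelianisation, identified with \<open>V\<close>.\<close>

lemma derived_nilG: "derived nilG (carrier nilG) = {x. fst x = 0}"
proof
  show "derived nilG (carrier nilG) \<subseteq> {x. fst x = 0}"
    unfolding derived_def
  proof
    fix x assume "x \<in> generate nilG (derived_set nilG (carrier nilG))"
    then show "x \<in> {x. fst x = 0}"
    proof (induction rule: generate.induct)
      case (incl h)
      then obtain x y where "h = bracket x y"
        by (simp only: UN_iff singleton_iff commutator_nilG) blast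
      then show ?case by simp
    next
      case (inv h)
      then obtain x y where "h = bracket x y"
        by (simp only: UN_iff singleton_iff commutator_nilG) blast
      then show ?case by (simp add: inv_nilG)
    qed auto
  qed
next
  let ?D = "derived nilG (carrier nilG)"
  have comm: "bracket x y \<in> ?D" for x y
  proof -
    have "bracket x y \<in> derived_set nilG (carrier nilG)"
      by (simp only: UN_iff singleton_iff commutator_nilG nilG_simps(1)) blast
    then show ?thesis unfolding derived_def by (rule generate.incl)
  qed
  have add: "x + y \<in> ?D" if "x \<in> ?D" "y \<in> ?D" "fst x = 0" for x y
    using generate.eng[of x nilG _ y] that by (simp add: derived_def bracket_central)
  have "A \<in> Wedge2 \<and> (0, modW A) \<in> ?D" if "A \<in> span {v \<^bold>\<and> w | v w. True}" for A
    using that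
  proof (induction rule: span_induct_alt)
    case base
    show ?case
      using comm[of 0 0] subspace_0[OF subspace_Wedge2] by (simp add: modW_0 zero_prod_def)
  next
    case (step c A B)
    then obtain v w where A: "A = v \<^bold>\<and> w" by blast
    have B: "B \<in> Wedge2" "(0, modW B) \<in> ?D" using step by auto
    have "(0, modW (c *\<^sub>R A)) = bracket (c *\<^sub>R v, 0) (w, 0)"
      by (simp add: bracket_def A wedge_scaleR)
    then have "(0, modW (c *\<^sub>R A)) + (0, modW B) \<in> ?D"
      using comm[of "(c *\<^sub>R v, 0)" "(w, 0)"] B(2) by (intro add) simp_all
    moreover have "c *\<^sub>R A \<in> Wedge2"
      unfolding A by (intro subspace_scale[OF subspace_Wedge2] wedge_in_Wedge2)
    ultimately show ?case
      using B by (simp add: modW_add subspace_add[OF subspace_Wedge2])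
  qed
  then have *: "(0, modW A) \<in> ?D" if "A \<in> Wedge2" for A
    using that unfolding Wedge2_def by blast
  show "{x. fst x = 0} \<subseteq> ?D"
  proof
    fix x :: lie assume "x \<in> {x. fst x = 0}"
    moreover obtain A where "A \<in> Wedge2" "snd x = modW A" using modW_surj by blast
    ultimately show "x \<in> ?D" using *[of A] by (metis mem_Collect_eq prod.collapse)
  qed
qed


section \<open>Continuous automorphisms\<close>

text \<open>Members are linear by \<open>Aut_linear\<close> below, so the inverse is automatically continuous.\<close>

definition Aut :: "(lie \<Rightarrow> lie) set" where
  "Aut = {\<tau> \<in> iso nilG nilG. continuous_on UNIV \<tau>}"

text \<open>The map induced on \<open>G/[G,G] = V\<close>, see \<open>factor_fst\<close> below.\<close>

definition factor :: "(lie \<Rightarrow> lie) \<Rightarrow> real^5 \<Rightarrow> real^5" where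
  "factor \<tau> v = fst (\<tau> (v, 0))"

lemma linear_if_additive_continuous:
  fixes f :: "'a::real_normed_vector \<Rightarrow> 'b::real_normed_vector"
  assumes add: "\<And>x y. f (x + y) = f x + f y" and cont: "continuous_on UNIV f"
  shows "linear f"
proof (rule linearI)
  fix c :: real and x :: 'a
  interpret additive f by standard (rule add)
  have nat: "f (real n *\<^sub>R y) = real n *\<^sub>R f y" for n y
    by (induction n) (simp_all add: zero scaleR_add_left add)
  have int: "f (of_int k *\<^sub>R y) = of_int k *\<^sub>R f y" for k y
    by (cases k rule: int_cases2) (simp_all add: nat minus)
  have rat: "f (q *\<^sub>R x) = q *\<^sub>R f x" if "q \<in> \<rat>" for q
  proof -
    obtain a b where q: "q = of_int a / of_int b" "b > (0::int)"
      using Rats_cases'[OF \<open>q \<in> \<rat>\<close>] by metis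
    have "of_int b *\<^sub>R f (q *\<^sub>R x) = f (of_int a *\<^sub>R x)"
      using q by (simp flip: int)
    also have "\<dots> = of_int b *\<^sub>R (q *\<^sub>R f x)"
      using q by (simp add: int)
    finally show ?thesis using q by (simp only: scaleR_cancel_left) simp
  qed
  have "closed {q. f (q *\<^sub>R x) = q *\<^sub>R f x}"
    by (intro closed_Collect_eq continuous_intros continuous_on_compose2[OF cont]) auto
  then have "closure \<rat> \<subseteq> {q. f (q *\<^sub>R x) = q *\<^sub>R f x}"
    using rat by (intro closure_minimal) auto
  then show "f (c *\<^sub>R x) = c *\<^sub>R f x"
    by (auto simp: Rats_closure_real)
qed (rule add)

lemma Aut_linear:
  assumes "\<tau> \<in> Aut"
  shows "linear \<tau>"
proof (rule linear_if_additive_continuous)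
  show "continuous_on UNIV \<tau>" using assms by (simp add: Aut_def)
  interpret h: group_hom nilG nilG \<tau>
    using assms by unfold_locales (auto simp: Aut_def iso_def)
  have hom: "\<tau> (x \<otimes>\<^bsub>nilG\<^esub> y) = \<tau> x \<otimes>\<^bsub>nilG\<^esub> \<tau> y" for x y
    by (rule h.hom_mult) simp_all
  have inv: "\<tau> (- x) = - \<tau> x" for x
    using h.hom_inv[of x] by (simp add: inv_nilG)
  have br: "\<tau> (bracket x y) = bracket (\<tau> x) (\<tau> y)" for x y
    unfolding commutator_nilG[symmetric] by (simp only: hom inv inv_nilG)
  have half: "\<tau> ((1/2) *\<^sub>R z) = (1/2) *\<^sub>R \<tau> z" for z
  proof -
    have "(1/2) *\<^sub>R z \<otimes>\<^bsub>nilG\<^esub> (1/2) *\<^sub>R z = z"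
      by (simp add: bracket_scaleR flip: scaleR_add_left)
    then have "\<tau> z = \<tau> ((1/2) *\<^sub>R z) + \<tau> ((1/2) *\<^sub>R z)"
      using hom[of "(1/2) *\<^sub>R z" "(1/2) *\<^sub>R z"] by simp
    then show ?thesis by (simp add: scaleR_add_right flip: scaleR_add_left)
  qed
  fix x y
  have "x + y = (x \<otimes>\<^bsub>nilG\<^esub> y) \<otimes>\<^bsub>nilG\<^esub> (- ((1/2) *\<^sub>R bracket x y))"
    by (simp add: bracket_uminus bracket_scaleR)
  then have "\<tau> (x + y) = (\<tau> x \<otimes>\<^bsub>nilG\<^esub> \<tau> y) \<otimes>\<^bsub>nilG\<^esub> (- ((1/2) *\<^sub>R bracket (\<tau> x) (\<tau> y)))"
    by (simp only: hom inv half br)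
  also have "\<dots> = \<tau> x + \<tau> y"
    by (simp add: bracket_uminus bracket_scaleR)
  finally show "\<tau> (x + y) = \<tau> x + \<tau> y" .
qed

lemma Aut_frechet_derivative:
  assumes "\<tau> \<in> Aut"
  shows "frechet_derivative \<tau> (at 0) = \<tau>"
  using frechet_derivative_at[OF linear_imp_has_derivative[OF Aut_linear[OF assms]]] by (rule sym)

lemma factor_fst:
  assumes "\<tau> \<in> Aut"
  shows "fst (\<tau> g) = factor \<tau> (fst g)"
proof -
  interpret h: group_hom nilG nilG \<tau>
    using assms by unfold_locales (auto simp: Aut_def iso_def)
  have "\<tau> ` derived nilG (carrier nilG) = derived nilG (\<tau> ` carrier nilG)"
    by (rule h.derived_img[symmetric]) simp
  moreover have "\<tau> ` carrier nilG = carrier nilG"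
    using assms by (simp add: Aut_def iso_def bij_betw_def)
  ultimately have "\<tau> ` {x. fst x = 0} = {x. fst x = 0}"
    by (simp only: derived_nilG)
  moreover have "\<tau> (0, snd g) \<in> \<tau> ` {x. fst x = 0}" by (rule imageI) simp
  ultimately have "fst (\<tau> (0, snd g)) = 0" by simp
  moreover have "\<tau> g = \<tau> (fst g, 0) + \<tau> (0, snd g)"
    using linear_add[OF Aut_linear[OF assms], of "(fst g, 0)" "(0, snd g)"] by simp
  ultimately show ?thesis by (simp add: factor_def)
qed

lemma linear_factor: "\<tau> \<in> Aut \<Longrightarrow> linear (factor \<tau>)"
proof (rule linearI)
  assume \<tau>: "\<tau> \<in> Aut"
  show "factor \<tau> (v + w) = factor \<tau> v + factor \<tau> w" for v w
    using linear_add[OF Aut_linear[OF \<tau>], of "(v, 0)" "(w, 0)"] by (simp add: factor_def)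
  show "factor \<tau> (c *\<^sub>R v) = c *\<^sub>R factor \<tau> v" for c v
    using linear_scale[OF Aut_linear[OF \<tau>], of c "(v, 0)"] by (simp add: factor_def)
qed


section \<open>Lattices and the homogeneous space\<close>

lemma coset_in_lcosets: "g <#\<^bsub>nilG\<^esub> \<Gamma> \<in> lcosets\<^bsub>nilG\<^esub> \<Gamma>"
  unfolding LCOSETS_def by (rule UN_I[of g]) simp_all

definition coset_topology :: "lie set \<Rightarrow> lie set topology" where
  "coset_topology \<Gamma> = topology (\<lambda>U. U \<subseteq> lcosets\<^bsub>nilG\<^esub> \<Gamma> \<and> open {g. g <#\<^bsub>nilG\<^esub> \<Gamma> \<in> U})"

lemma openin_coset_topology:
  "openin (coset_topology \<Gamma>) U \<longleftrightarrow> U \<subseteq> lcosets\<^bsub>nilG\<^esub> \<Gamma> \<and> open {g. g <#\<^bsub>nilG\<^esub> \<Gamma> \<in> U}"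
proof -
  have "istopology (\<lambda>U. U \<subseteq> lcosets\<^bsub>nilG\<^esub> \<Gamma> \<and> open {g. g <#\<^bsub>nilG\<^esub> \<Gamma> \<in> U})"
    unfolding istopology_def
  proof (intro conjI allI impI)
    fix S T assume "S \<subseteq> lcosets\<^bsub>nilG\<^esub> \<Gamma> \<and> open {g. g <#\<^bsub>nilG\<^esub> \<Gamma> \<in> S}"
      and "T \<subseteq> lcosets\<^bsub>nilG\<^esub> \<Gamma> \<and> open {g. g <#\<^bsub>nilG\<^esub> \<Gamma> \<in> T}"
    then show "S \<inter> T \<subseteq> lcosets\<^bsub>nilG\<^esub> \<Gamma>" "open {g. g <#\<^bsub>nilG\<^esub> \<Gamma> \<in> S \<inter> T}"
      by (auto simp: Collect_conj_eq)
  next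
    fix K assume K: "\<forall>S\<in>K. S \<subseteq> lcosets\<^bsub>nilG\<^esub> \<Gamma> \<and> open {g. g <#\<^bsub>nilG\<^esub> \<Gamma> \<in> S}"
    then show "\<Union>K \<subseteq> lcosets\<^bsub>nilG\<^esub> \<Gamma>" by blast
    have "{g. g <#\<^bsub>nilG\<^esub> \<Gamma> \<in> \<Union>K} = (\<Union>S\<in>K. {g. g <#\<^bsub>nilG\<^esub> \<Gamma> \<in> S})" by blast
    then show "open {g. g <#\<^bsub>nilG\<^esub> \<Gamma> \<in> \<Union>K}" using K by auto
  qed
  then show ?thesis by (simp add: coset_topology_def topology_inverse')
qed

lemma topspace_coset_topology: "topspace (coset_topology \<Gamma>) = lcosets\<^bsub>nilG\<^esub> \<Gamma>"
proof -
  have "{g. g <#\<^bsub>nilG\<^esub> \<Gamma> \<in> lcosets\<^bsub>nilG\<^esub> \<Gamma>} = UNIV"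
    by (simp add: coset_in_lcosets)
  then have "openin (coset_topology \<Gamma>) (lcosets\<^bsub>nilG\<^esub> \<Gamma>)"
    by (simp add: openin_coset_topology)
  from openin_subset[OF this] show ?thesis
    using openin_topspace[of "coset_topology \<Gamma>"]
    by (intro antisym) (simp_all only: openin_coset_topology)
qed

definition is_lattice :: "lie set \<Rightarrow> bool" where
  "is_lattice \<Gamma> \<longleftrightarrow> subgroup \<Gamma> nilG \<and> discrete \<Gamma> \<and> compact_space (coset_topology \<Gamma>)"

text \<open>The induced map \<open>g\<Gamma> \<mapsto> \<tau>(g)\<Gamma>\<close>; it sends a coset to its image under \<open>\<tau>\<close>.\<close>

definition induced :: "lie set \<Rightarrow> (lie \<Rightarrow> lie) \<Rightarrow> lie set \<Rightarrow> lie set" where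
  "induced \<Gamma> \<tau> = (\<lambda>C \<in> lcosets\<^bsub>nilG\<^esub> \<Gamma>. \<tau> ` C)"

lemma induced_coset:
  assumes "\<tau> \<in> Aut" "\<tau> ` \<Gamma> = \<Gamma>"
  shows "induced \<Gamma> \<tau> (g <#\<^bsub>nilG\<^esub> \<Gamma>) = \<tau> g <#\<^bsub>nilG\<^esub> \<Gamma>"
proof -
  interpret h: group_hom nilG nilG \<tau>
    using assms by unfold_locales (auto simp: Aut_def iso_def)
  have hom: "\<tau> (x \<otimes>\<^bsub>nilG\<^esub> y) = \<tau> x \<otimes>\<^bsub>nilG\<^esub> \<tau> y" for x y
    by (rule h.hom_mult) simp_all
  have "g <#\<^bsub>nilG\<^esub> \<Gamma> \<in> lcosets\<^bsub>nilG\<^esub> \<Gamma>" by (rule coset_in_lcosets)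
  moreover have c: "g <#\<^bsub>nilG\<^esub> \<Gamma> = (\<lambda>h. g \<otimes>\<^bsub>nilG\<^esub> h) ` \<Gamma>" for g
    unfolding l_coset_def by blast
  moreover have "\<tau> ` (\<lambda>h. g \<otimes>\<^bsub>nilG\<^esub> h) ` \<Gamma> = (\<lambda>h. \<tau> g \<otimes>\<^bsub>nilG\<^esub> h) ` \<tau> ` \<Gamma>"
    by (simp only: image_image hom)
  ultimately show ?thesis by (simp only: induced_def restrict_apply' assms(2) c)
qed


section \<open>Anosov automorphisms and ergodicity\<close>

text \<open>\<open>z\<close> is an eigenvalue of the complexification of \<open>L\<close>, with eigenvector \<open>x + i y\<close>.\<close>

definition complex_eigenvalue :: "('a::real_vector \<Rightarrow> 'a) \<Rightarrow> complex \<Rightarrow> bool" where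
  "complex_eigenvalue L z \<longleftrightarrow> (\<exists>x y. (x, y) \<noteq> (0, 0) \<and>
     L x = Re z *\<^sub>R x - Im z *\<^sub>R y \<and> L y = Im z *\<^sub>R x + Re z *\<^sub>R y)"

definition hyperbolic :: "('a::real_vector \<Rightarrow> 'a) \<Rightarrow> bool" where
  "hyperbolic L \<longleftrightarrow> (\<forall>z. complex_eigenvalue L z \<longrightarrow> cmod z \<noteq> 1)"

text \<open>The derivative on the Lie algebra is the derivative at the neutral element \<open>0\<close>, whose
  tangent space is the Lie algebra.\<close>

definition anosov_automorphism :: "lie set \<Rightarrow> (lie set \<Rightarrow> lie set) \<Rightarrow> bool" where
  "anosov_automorphism \<Gamma> f \<longleftrightarrow>
     (\<exists>\<tau>\<in>Aut. \<tau> ` \<Gamma> = \<Gamma> \<and> f = induced \<Gamma> \<tau> \<and> hyperbolic (frechet_derivative \<tau> (at 0)))"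

definition invariant_prob :: "lie set \<Rightarrow> lie set measure \<Rightarrow> bool" where
  "invariant_prob \<Gamma> \<mu> \<longleftrightarrow> prob_space \<mu> \<and> space \<mu> = lcosets\<^bsub>nilG\<^esub> \<Gamma> \<and>
     sets \<mu> = sigma_sets (lcosets\<^bsub>nilG\<^esub> \<Gamma>) {U. openin (coset_topology \<Gamma>) U} \<and>
     (\<forall>g. \<forall>A\<in>sets \<mu>. emeasure \<mu> ((\<lambda>C. g <#\<^bsub>nilG\<^esub> C) ` A) = emeasure \<mu> A)"

text \<open>Triviality of invariant sets; maps induced by automorphisms preserve the invariant
  probability measure by its uniqueness, so preservation is not repeated here.\<close>

definition ergodic :: "'a measure \<Rightarrow> ('a \<Rightarrow> 'a) \<Rightarrow> bool" where
  "ergodic M f \<longleftrightarrow> (\<forall>A\<in>sets M. f -` A \<inter> space M = A \<longrightarrow> measure M A = 0 \<or> measure M A = 1)"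

end

theory Submission
  imports Defs
begin

text \<open>Let \<open>A\<close> be the factor of \<open>\<tau>\<close> on \<open>V\<close>; it satisfies \<open>A X A\<^sup>T \<in> W\<close> for \<open>X \<in> W\<close>. A vector \<open>v\<close> defines the
  quadratic form \<open>x \<mapsto> x \<and> x \<and> v\<close> on the 3-dimensional space \<open>W\<close>, and if \<open>det A = 1\<close> then \<open>A\<close> acts on these
  forms by a congruence \<open>C\<close>. The forms so obtained are those annihilated by one nondegenerate
  indefinite tensor \<open>\<Omega>\<close>, so \<open>C\<close> preserves \<open>\<Omega>\<close> up to a positive factor, and \<open>det A = 1\<close> makes this factor \<open>1\<close>.
  An isometry of a 3-dimensional form has an eigenvector \<open>x\<close> with eigenvalue \<open>\<plusminus>1\<close>; the covector
  \<open>v \<mapsto> x \<and> x \<and> v\<close> is then nonzero and fixed by \<open>A\<close>, so \<open>1\<close> is an eigenvalue of \<open>A\<close>.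

  The projection \<open>L\<close> of a lattice \<open>\<Gamma>\<close> to \<open>V\<close> spans \<open>V\<close> by cocompactness and is discrete because
  commutators of small elements with a basis lie in \<open>\<Gamma>\<close> near \<open>0\<close>. Hence \<open>A L = L\<close> forces \<open>det A = \<plusminus>1\<close>, and
  \<open>A\<close> has an eigenvalue \<open>c = \<plusminus>1\<close>, which excludes hyperbolicity. Since \<open>A\<close> is rational with respect to
  \<open>L\<close>, some \<open>\<xi> \<noteq> 0\<close> is integral on \<open>L\<close> with \<open>\<xi> \<circ> A = c \<xi>\<close>, and the cosets \<open>g \<Gamma>\<close> for which
  \<open>\<xi> (g)\<close> is within \<open>1/4\<close> of an integer form an invariant set of measure strictly between \<open>0\<close> and \<open>1\<close>.\<close>

section \<open>Exterior products in dimension five\<close>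

lemma exhaust_5:
  fixes x :: 5
  shows "x = 1 \<or> x = 2 \<or> x = 3 \<or> x = 4 \<or> x = 5"
proof (induct x)
  case (of_int z)
  then have "0 \<le> z" and "z < 5" by simp_all
  then have "z = 0 \<or> z = 1 \<or> z = 2 \<or> z = 3 \<or> z = 4" by arith
  then show ?case by auto
qed

lemma forall_5: "(\<forall>i::5. P i) \<longleftrightarrow> P 1 \<and> P 2 \<and> P 3 \<and> P 4 \<and> P 5"
proof
  assume P: "P 1 \<and> P 2 \<and> P 3 \<and> P 4 \<and> P 5"
  show "\<forall>i. P i"
  proof
    fix i :: 5
    show "P i" using exhaust_5[of i] P by (elim disjE) simp_all
  qed
qed simp

lemma UNIV_5: "(UNIV::5 set) = {1,2,3,4,5}"
  using exhaust_5 by auto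

lemma sum_5: "sum f (UNIV::5 set) = f 1 + f 2 + f 3 + f 4 + f 5"
  unfolding UNIV_5 by (simp add: ac_simps)

text \<open>The coefficient of \<open>4 X \<and> Y \<and> v\<close> with respect to \<open>\<sigma> 1 \<and> \<dots> \<and> \<sigma> 5\<close>.\<close>

definition vol :: "real^5^5 \<Rightarrow> real^5^5 \<Rightarrow> real^5 \<Rightarrow> real" where
  "vol X Y v = (\<Sum>p | p permutes UNIV. of_int (sign p) * (X $ p 1 $ p 2 * Y $ p 3 $ p 4 * v $ p 5))"

text \<open>Reindexing by composition with the transposition of \<open>i\<close> and
  \<open>j\<close> reverses every sign. This makes alternating sums change sign when two factors are
  exchanged.\<close>

lemma sum_permutations_swap:
  fixes F :: "('n::finite \<Rightarrow> 'n) \<Rightarrow> real"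
  assumes "i \<noteq> j"
  shows "(\<Sum>p | p permutes UNIV. of_int (sign p) * F (p \<circ> Transposition.transpose i j)) =
    - (\<Sum>p | p permutes UNIV. of_int (sign p) * F p)"
proof -
  have t: "Transposition.transpose i j permutes UNIV" by (rule permutes_swap_id) simp_all
  have "(\<Sum>p | p permutes UNIV. of_int (sign p) * F p) =
    (\<Sum>p | p permutes UNIV. of_int (sign (p \<circ> Transposition.transpose i j)) * F (p \<circ> Transposition.transpose i j))"
    by (rule sum_permutations_compose_right[OF t])
  also have "\<dots> = (\<Sum>p | p permutes UNIV. - (of_int (sign p) * F (p \<circ> Transposition.transpose i j)))"
  proof (rule sum.cong[OF refl])
    fix p :: "'n \<Rightarrow> 'n" assume "p \<in> {p. p permutes UNIV}"
    then have "permutation p" by (simp add: permutation_permutes) blast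
    then have "sign (p \<circ> Transposition.transpose i j) = - sign p"
      using assms by (simp add: sign_compose permutation_swap_id sign_swap_id)
    then show "of_int (sign (p \<circ> Transposition.transpose i j)) * F (p \<circ> Transposition.transpose i j) = - (of_int (sign p) * F (p \<circ> Transposition.transpose i j))"
      by simp
  qed
  finally show ?thesis by (simp add: sum_negf)
qed

definition rows5 :: "'a \<Rightarrow> 'a \<Rightarrow> 'a \<Rightarrow> 'a \<Rightarrow> 'a \<Rightarrow> 'a^5" where
  "rows5 a b c d e = (\<chi> i. if i = 1 then a else if i = 2 then b else if i = 3 then c else if i = 4 then d else e)"

lemma det_rows5:
  "det (rows5 a b c d e :: real^5^5) =
    (\<Sum>p | p permutes UNIV. of_int (sign p) * (a $ p 1 * b $ p 2 * c $ p 3 * d $ p 4 * e $ p 5))"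
proof -
  have "(\<Prod>i\<in>UNIV. f i) = f 1 * f 2 * f 3 * f 4 * f 5" for f :: "5 \<Rightarrow> real"
    unfolding UNIV_5 by simp
  then show ?thesis
    unfolding det_def rows5_def by simp
qed

text \<open>Each wedge is a difference of two tensors. Each of the four resulting alternating sums
  equals the first up to exactly the sign it carries, whence the factor 4.\<close>

lemma vol_wedge: "vol (a \<^bold>\<and> b) (c \<^bold>\<and> d) v = 4 * det (rows5 a b c d v)"
proof -
  let ?S = "\<lambda>F. \<Sum>p | p permutes (UNIV::5 set). of_int (sign p) * (F p :: real)"
  define F where "F a b c d = (\<lambda>p. a $ p 1 * b $ p 2 * c $ p 3 * d $ p 4 * v $ p (5::5) :: real)" for a b c d :: "real^5"
  have 1: "?S (F b a c d) = - ?S (F a b c d)" for a b c d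
    using sum_permutations_swap[of 1 2 "F a b c d"]
    by (simp add: F_def Transposition.transpose_def mult.commute mult.left_commute)
  have 2: "?S (F a b d c) = - ?S (F a b c d)" for a b c d
    using sum_permutations_swap[of 3 4 "F a b c d"]
    by (simp add: F_def Transposition.transpose_def mult.commute mult.left_commute)
  have "vol (a \<^bold>\<and> b) (c \<^bold>\<and> d) v = ?S (F a b c d) - ?S (F b a c d) - ?S (F a b d c) + ?S (F b a d c)"
    unfolding vol_def sum_subtractf[symmetric] sum.distrib[symmetric]
    by (rule sum.cong) (simp_all add: wedge_def F_def algebra_simps)
  moreover have "det (rows5 a b c d v) = ?S (F a b c d)"
    by (simp add: det_rows5 F_def)
  ultimately show ?thesis
    using 1[of a b c d] 1[of a b d c] 2[of a b c d] by linarith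
qed

lemma vol_linear:
  "vol (X + X') Y v = vol X Y v + vol X' Y v" "vol (c *\<^sub>R X) Y v = c * vol X Y v"
  "vol X (Y + Y') v = vol X Y v + vol X Y' v" "vol X (c *\<^sub>R Y) v = c * vol X Y v"
  unfolding vol_def sum.distrib[symmetric] sum_distrib_left
  by ((rule sum.cong[OF refl], simp add: distrib_left distrib_right)+)

lemma vol_0: "vol 0 Y v = 0" "vol X 0 v = 0"
  by (simp_all add: vol_def)

text \<open>The map induced by \<open>A\<close> on the exterior square, written for skew-symmetric
  matrices; \<open>act_wedge\<close> confirms this on decomposable tensors.\<close>

definition act :: "real^5^5 \<Rightarrow> real^5^5 \<Rightarrow> real^5^5" where
  "act A X = A ** X ** transpose A"

lemma matrix_add_rdistrib:
  fixes A B :: "real^'n^'m"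
  shows "(A + B) ** C = A ** C + B ** C"
  by (simp add: vec_eq_iff matrix_matrix_mult_def distrib_right sum.distrib)

lemma linear_act: "linear (act A)"
proof (rule linearI)
  show "act A (X + Y) = act A X + act A Y" for X Y
    unfolding act_def matrix_add_ldistrib by (rule matrix_add_rdistrib)
  show "act A (c *\<^sub>R X) = c *\<^sub>R act A X" for c X
    unfolding act_def matrix_scalar_ac scalar_matrix_assoc[symmetric] by (rule refl)
qed

lemma act_wedge: "act A (a \<^bold>\<and> b) = (A *v a) \<^bold>\<and> (A *v b)"
proof -
  have 1: "(A ** (a \<^bold>\<and> b)) $ i $ l = (A *v a) $ i * b $ l - (A *v b) $ i * a $ l" for i l
    by (simp add: matrix_matrix_mult_def matrix_vector_mult_def wedge_def sum_distrib_right
        sum_subtractf right_diff_distrib mult.assoc) (simp add: mult.commute mult.left_commute)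
  have "act A (a \<^bold>\<and> b) $ i $ j = (\<Sum>l\<in>UNIV. (A ** (a \<^bold>\<and> b)) $ i $ l * A $ j $ l)" for i j
    by (simp add: act_def matrix_matrix_mult_def transpose_def)
  then have "act A (a \<^bold>\<and> b) $ i $ j = ((A *v a) \<^bold>\<and> (A *v b)) $ i $ j" for i j
    unfolding 1
    by (simp add: wedge_def left_diff_distrib sum_subtractf mult.assoc flip: sum_distrib_left)
       (simp add: matrix_vector_mult_def mult.commute)
  then show ?thesis by (simp add: vec_eq_iff)
qed

lemma rows5_mult:
  fixes A :: "real^5^5"
  shows "rows5 (A *v a) (A *v b) (A *v c) (A *v d) (A *v e) = rows5 a b c d e ** transpose A"
proof -
  have "(A *v x) $ j = (\<Sum>k\<in>UNIV. x $ k * A $ j $ k)" for x j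
    unfolding matrix_vector_mult_def vec_lambda_beta by (rule sum.cong[OF refl]) (rule mult.commute)
  then show ?thesis
    by (simp add: rows5_def vec_eq_iff matrix_matrix_mult_def transpose_def)
qed

text \<open>For decomposable \<open>X\<close> and \<open>Y\<close> this is multiplicativity of the
  determinant, through \<open>vol_wedge\<close>. Both sides are bilinear in \<open>X\<close> and
  \<open>Y\<close>, and decomposable tensors span \<open>Wedge2\<close>.\<close>

lemma vol_act:
  assumes "X \<in> Wedge2" "Y \<in> Wedge2"
  shows "vol (act A X) (act A Y) (A *v v) = det A * vol X Y v"
proof -
  have wedges: "vol (act A (a \<^bold>\<and> b)) (act A (c \<^bold>\<and> d)) (A *v v) = det A * vol (a \<^bold>\<and> b) (c \<^bold>\<and> d) v" for a b c d
    unfolding act_wedge vol_wedge rows5_mult det_mul det_transpose by simp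
  have left: "vol (act A (a \<^bold>\<and> b)) (act A Y) (A *v v) = det A * vol (a \<^bold>\<and> b) Y v"
    if "Y \<in> span {v \<^bold>\<and> w | v w. True}" for a b Y
    using that
  proof (induction rule: span_induct_alt)
    case base
    show ?case by (simp add: linear_0[OF linear_act] vol_0)
  next
    case (step k Y Y')
    from step.hyps obtain c d where "Y = c \<^bold>\<and> d" by blast
    then show ?case
      unfolding linear_add[OF linear_act] linear_scale[OF linear_act] vol_linear step.IH
      by (simp add: wedges distrib_left)
  qed
  have "X \<in> span {v \<^bold>\<and> w | v w. True}" using assms by (simp add: Wedge2_def)
  then show ?thesis
  proof (induction rule: span_induct_alt)
    case base
    show ?case by (simp add: linear_0[OF linear_act] vol_0)
  next
    case (step k X X')
    from step.hyps obtain c d where "X = c \<^bold>\<and> d" by blast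
    then show ?case
      unfolding linear_add[OF linear_act] linear_scale[OF linear_act] vol_linear step.IH
      using left[of Y c d] assms(2) by (simp add: Wedge2_def distrib_left)
  qed
qed

section \<open>Quadratic forms on W\<close>

definition wcomb :: "real^3 \<Rightarrow> real^5^5" where
  "wcomb x = (x $ 1) *\<^sub>R w1 + (x $ 2) *\<^sub>R w2 + (x $ 3) *\<^sub>R w3"

text \<open>The form \<open>x \<and> y \<and> v\<close> on \<open>W\<close> in the basis \<open>w1, w2, w3\<close>, divided by \<open>-2\<close>.\<close>

definition gram :: "real^5 \<Rightarrow> real^3^3" where
  "gram v = vector [vector [v $ 5, - v $ 4 / 2, v $ 3 / 2],
     vector [- v $ 4 / 2, v $ 3, - v $ 2 / 2],
     vector [v $ 3 / 2, - v $ 2 / 2, v $ 1]]"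

lemma wcomb_nth:
  "wcomb x $ 1 $ 1 = 0" "wcomb x $ 1 $ 2 = 0" "wcomb x $ 1 $ 3 = 0" "wcomb x $ 1 $ 4 = x $ 1" "wcomb x $ 1 $ 5 = x $ 2"
  "wcomb x $ 2 $ 1 = 0" "wcomb x $ 2 $ 2 = 0" "wcomb x $ 2 $ 3 = - x $ 1" "wcomb x $ 2 $ 4 = - x $ 2" "wcomb x $ 2 $ 5 = x $ 3"
  "wcomb x $ 3 $ 1 = 0" "wcomb x $ 3 $ 2 = x $ 1" "wcomb x $ 3 $ 3 = 0" "wcomb x $ 3 $ 4 = - x $ 3" "wcomb x $ 3 $ 5 = 0"
  "wcomb x $ 4 $ 1 = - x $ 1" "wcomb x $ 4 $ 2 = x $ 2" "wcomb x $ 4 $ 3 = x $ 3" "wcomb x $ 4 $ 4 = 0" "wcomb x $ 4 $ 5 = 0"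
  "wcomb x $ 5 $ 1 = - x $ 2" "wcomb x $ 5 $ 2 = - x $ 3" "wcomb x $ 5 $ 3 = 0" "wcomb x $ 5 $ 4 = 0" "wcomb x $ 5 $ 5 = 0"
  by (simp_all add: wcomb_def w1_def w2_def w3_def wedge_\<sigma>_nth)


text \<open>A permutation of \<open>insert a S\<close> is a permutation of \<open>S\<close> followed
  by the transposition of \<open>a\<close> with some \<open>b\<close>. Iterating the splitting lists
  the permutations of five indices with their signs.\<close>

lemma sum_sign_permutations_insert:
  fixes F :: "('n::finite \<Rightarrow> 'n) \<Rightarrow> real"
  assumes "finite S" "a \<notin> S"
  shows "(\<Sum>p | p permutes insert a S. of_int (sign p) * F p) =
    (\<Sum>b\<in>insert a S. (if a = b then 1 else -1) *
      (\<Sum>q | q permutes S. of_int (sign q) * F (Transposition.transpose a b \<circ> q)))"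
proof -
  have "sign (Transposition.transpose a b \<circ> q) = (if a = b then 1 else -1) * sign q" if "q permutes S" for q b
    using that assms(1) by (simp add: sign_compose permutation_swap_id sign_swap_id permutation_permutes)
      (metis assms(1) mult_minus1 permutation_permutes permutation_swap_id sign_compose sign_swap_id)
  then show ?thesis
    unfolding sum_over_permutations_insert[OF assms] sum_distrib_left
    by (intro sum.cong refl) (simp add: sum_negf)
qed

text \<open>The constant combines the factor 4 in \<open>vol\<close> with the factor -2 removed in
  \<open>gram\<close>.\<close>

lemma vol_wcomb: "vol (wcomb x) (wcomb y) v = -8 * (x \<bullet> (gram v *v y))"
proof -
  have ins: "finite {2::5, 3, 4, 5}" "1 \<notin> {2::5, 3, 4, 5}" "finite {3::5, 4, 5}" "2 \<notin> {3::5, 4, 5}"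
    "finite {4::5, 5}" "3 \<notin> {4::5, 5}" "finite {5::5}" "4 \<notin> {5::5}"
    by simp_all

  define f where "f a b c d e = wcomb x $ a $ b * wcomb y $ c $ d * v $ e" for a b c d e :: 5
  define T where "T = (Transposition.transpose :: 5 \<Rightarrow> _)"
  have T: "T a b c = (if c = a then b else if c = b then a else c)" for a b c
    by (simp add: T_def Transposition.transpose_def)
  have "vol (wcomb x) (wcomb y) v = (\<Sum>p | p permutes UNIV. of_int (sign p) * f (p 1) (p 2) (p 3) (p 4) (p 5))"
    by (simp add: vol_def f_def)
  also have "\<dots> = (\<Sum>b1\<in>{1, 2, 3, 4, 5}. (if 1 = b1 then 1 else - 1) *
       (\<Sum>b2\<in>{2, 3, 4, 5}. (if 2 = b2 then 1 else - 1) *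
         (\<Sum>b3\<in>{3, 4, 5}. (if 3 = b3 then 1 else - 1) *
           (\<Sum>b4\<in>{4, 5}. (if 4 = b4 then 1 else - 1) *
             f (T 1 b1 (T 2 b2 (T 3 b3 (T 4 b4 1)))) (T 1 b1 (T 2 b2 (T 3 b3 (T 4 b4 2)))) 
               (T 1 b1 (T 2 b2 (T 3 b3 (T 4 b4 3)))) (T 1 b1 (T 2 b2 (T 3 b3 (T 4 b4 4))))
               (T 1 b1 (T 2 b2 (T 3 b3 (T 4 b4 5))))))))"
    unfolding UNIV_5
    unfolding sum_sign_permutations_insert[OF ins(1,2)]
    unfolding sum_sign_permutations_insert[OF ins(3,4)]
    unfolding sum_sign_permutations_insert[OF ins(5,6)]
    unfolding sum_sign_permutations_insert[OF ins(7,8)]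
    unfolding permutes_sing T_def[symmetric]
    by (intro sum.cong refl arg_cong2[where f="(*)"]) (simp add: sign_id)
  also have "\<dots> = -8 * (x \<bullet> (gram v *v y))"
    \<comment> \<open>The 120 terms are reduced in stages: expand sums and signs, evaluate the
      transpositions, then drop products with a zero entry of \<open>wcomb\<close>; only the
      survivors reach the algebra.\<close>
    by (simp only: sum.insert sum.empty finite.intros insert_iff empty_iff simp_thms neq_5
          if_True if_False mult_1 mult_minus_left add_0_right,
        simp only: T simp_thms neq_5 if_True if_False,
        simp only: f_def wcomb_nth mult_zero_left mult_zero_right add_0_left add_0_right minus_zero,
        simp add: inner_vec_def sum_3 gram_def matrix_vector_mult_def algebra_simps)
  finally show ?thesis .
qed

section \<open>Determinants, kernels and symmetric bilinear forms\<close>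

lemma det_scaleR:
  fixes A :: "real^'n^'n"
  shows "det (c *\<^sub>R A) = c ^ CARD('n) * det A"
proof -
  have "c *\<^sub>R A = (\<chi> i. c *s A $ i)" by (simp add: vec_eq_iff)
  then show ?thesis by (simp add: det_rows_mul)
qed

lemma det_0_iff_kernel:
  fixes A :: "'a::field^'n^'n"
  shows "det A = 0 \<longleftrightarrow> (\<exists>x. x \<noteq> 0 \<and> A *v x = 0)"
  using invertible_det_nz[of A] matrix_left_invertible_ker[of A] invertible_left_inverse[of A] by blast

lemma matrix_eqI_inner:
  fixes A B :: "real^'n^'m"
  assumes "\<And>x y. x \<bullet> (A *v y) = x \<bullet> (B *v y)"
  shows "A = B"
proof -
  have "A *v y = B *v y" for y
    using assms[of _ y] by (metis vector_eq_ldot)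
  then show ?thesis by (simp add: matrix_eq)
qed

lemma inner_transpose: "x \<bullet> (transpose A *v y) = (A *v x) \<bullet> (y :: real^'n)"
  by (metis dot_lmul_matrix inner_commute transpose_matrix_vector)

text \<open>Polarisation: the values at \<open>x + y\<close>, \<open>x\<close> and \<open>y\<close>
  determine the mixed value.\<close>

lemma symmetric_matrix_eqI:
  fixes A B :: "real^'n^'n"
  assumes "transpose A = A" "transpose B = B" and eq: "\<And>x. x \<bullet> (A *v x) = x \<bullet> (B *v x)"
  shows "A = B"
proof (rule matrix_eqI_inner)
  fix x y
  have sym: "x \<bullet> (M *v y) = y \<bullet> (M *v x)" if "transpose M = M" for M :: "real^'n^'n"
    using inner_transpose[of x M y] that by (simp add: inner_commute)
  have "(x + y) \<bullet> (M *v (x + y)) = x \<bullet> (M *v x) + y \<bullet> (M *v y) + 2 * (x \<bullet> (M *v y))"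
    if "transpose M = M" for M :: "real^'n^'n"
    using sym[OF that] by (simp add: matrix_vector_right_distrib inner_add_left inner_add_right)
  from this[OF assms(1)] this[OF assms(2)] show "x \<bullet> (A *v y) = x \<bullet> (B *v y)"
    using eq[of "x + y"] eq[of x] eq[of y] by linarith
qed

section \<open>The action on \<open>W\<close> and the induced congruence of forms\<close>

lemma linear_wcomb: "linear wcomb"
  by (rule linearI) (simp_all add: wcomb_def algebra_simps)

lemma W_eq_range: "W = range wcomb"
proof
  have "w1 = wcomb (axis 1 1)" "w2 = wcomb (axis 2 1)" "w3 = wcomb (axis 3 1)"
    by (simp_all add: wcomb_def axis_def)
  then have "{w1, w2, w3} \<subseteq> range wcomb" by blast
  then show "W \<subseteq> range wcomb"
    unfolding W_def by (intro span_minimal linear_subspace_image[OF linear_wcomb]) simp_all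
  have "w1 \<in> W" "w2 \<in> W" "w3 \<in> W" by (auto simp: W_def span_base)
  then show "range wcomb \<subseteq> W"
    by (auto simp: wcomb_def intro!: subspace_add subspace_scale subspace_W)
qed

lemma act_wcomb:
  assumes "\<And>X. X \<in> W \<Longrightarrow> act A X \<in> W"
  obtains B where "\<And>x. act A (wcomb x) = wcomb (B *v x)"
proof -
  have "\<exists>b. act A (wcomb (axis i 1)) = wcomb b" for i
    using assms[of "wcomb (axis i 1)"] W_eq_range by blast
  then obtain b where b: "\<And>i. act A (wcomb (axis i 1)) = wcomb (b i)" by metis
  have "act A (wcomb x) = wcomb ((\<chi> k i. b i $ k) *v x)" for x
  proof -
    have x: "x = x $ 1 *\<^sub>R axis 1 1 + x $ 2 *\<^sub>R axis 2 1 + x $ 3 *\<^sub>R axis 3 1"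
      by (simp add: vec_eq_iff forall_3 axis_def)
    have "act A (wcomb x) = x $ 1 *\<^sub>R wcomb (b 1) + x $ 2 *\<^sub>R wcomb (b 2) + x $ 3 *\<^sub>R wcomb (b 3)"
      by (subst x) (simp add: linear_add[OF linear_wcomb] linear_scale[OF linear_wcomb]
        linear_add[OF linear_act] linear_scale[OF linear_act] b)
    also have "\<dots> = wcomb (x $ 1 *\<^sub>R b 1 + x $ 2 *\<^sub>R b 2 + x $ 3 *\<^sub>R b 3)"
      by (simp add: linear_add[OF linear_wcomb] linear_scale[OF linear_wcomb])
    also have "x $ 1 *\<^sub>R b 1 + x $ 2 *\<^sub>R b 2 + x $ 3 *\<^sub>R b 3 = (\<chi> k i. b i $ k) *v x"
      by (simp add: vec_eq_iff matrix_vector_mult_def sum_3 mult.commute)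
    finally show ?thesis .
  qed
  then show ?thesis by (rule that)
qed

text \<open>Spans the annihilator of the matrices \<open>gram v\<close> in the symmetric matrices under the trace pairing;
  it comes from the relation \<open>w2 \<and> w2 = 2 w1 \<and> w3\<close>.\<close>

definition Om :: "real^3^3" where
  "Om = vector [vector [0, 0, -1], vector [0, 1, 0], vector [-1, 0, 0]]"

lemma det_Om: "det Om = -1"
  by (simp add: det_3 Om_def)

lemma transpose_Om: "transpose Om = Om"
  by (simp add: vec_eq_iff forall_3 transpose_def Om_def)

text \<open>With \<open>B\<close> the matrix of \<open>act A\<close> on \<open>W\<close>,
  \<open>vol_act\<close> and \<open>det A = 1\<close> say that \<open>B\<close> carries the form of
  \<open>A *v v\<close> back to that of \<open>v\<close>. The required \<open>C\<close> is the
  inverse of \<open>B\<close>.\<close>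

lemma gram_congruence:
  assumes "det A = 1" and W: "\<And>X. X \<in> W \<Longrightarrow> act A X \<in> W"
  obtains C where "det C \<noteq> 0" "\<And>v. gram (A *v v) = transpose C ** gram v ** C"
proof -
  obtain B where B: "\<And>x. act A (wcomb x) = wcomb (B *v x)"
    using act_wcomb[OF W] by blast
  have W2: "wcomb x \<in> Wedge2" for x
    using W_subset W_eq_range by blast
  have BG: "transpose B ** gram (A *v v) ** B = gram v" for v
  proof (rule matrix_eqI_inner)
    fix x y
    have "x \<bullet> ((transpose B ** gram (A *v v) ** B) *v y) = (B *v x) \<bullet> (gram (A *v v) *v (B *v y))"
      by (simp only: inner_transpose flip: matrix_vector_mul_assoc)
    also have "\<dots> = x \<bullet> (gram v *v y)"
      using vol_act[OF W2 W2, of A x y v] by (simp add: B vol_wcomb \<open>det A = 1\<close>)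
    finally show "x \<bullet> ((transpose B ** gram (A *v v) ** B) *v y) = x \<bullet> (gram v *v y)" .
  qed
  \<comment> \<open>One nondegenerate form (here of determinant 3/4) suffices to make
    \<open>B\<close> invertible.\<close>
  have "det (gram (axis 1 1 + axis 3 1 + axis 5 1)) \<noteq> 0"
    by (simp add: det_3 gram_def axis_def)
  then have "det B \<noteq> 0"
    using arg_cong[OF BG, of det "axis 1 1 + axis 3 1 + axis 5 1"] by (auto simp: det_mul)
  then obtain C where C: "B ** C = mat 1"
    using invertible_det_nz[of B] by (auto simp: invertible_def)
  have "det B * det C = 1" using arg_cong[OF C, of det] by (simp add: det_mul)
  then have "det C \<noteq> 0" by auto
  moreover have "gram (A *v v) = transpose C ** gram v ** C" for v
  proof -
    have C': "transpose C ** transpose B = mat 1"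
      using arg_cong[OF C, of transpose] by (simp add: matrix_transpose_mul)
    have "transpose C ** gram v ** C = (transpose C ** transpose B) ** gram (A *v v) ** (B ** C)"
      by (simp only: matrix_mul_assoc flip: BG[of v])
    then show ?thesis by (simp add: C C')
  qed
  ultimately show ?thesis by (rule that)
qed

text \<open>The five basis vectors give five independent linear conditions on the six entries of a
  symmetric \<open>K\<close>. The solutions form the line through \<open>Om\<close>, whose middle
  entry is 1.\<close>

lemma trace_gram_eq_0_imp:
  assumes "\<And>v. trace (gram v ** K) = 0" and "transpose K = K"
  shows "K = K $ 2 $ 2 *\<^sub>R Om"
proof -
  have "trace (gram v ** K) = v $ 5 * K $ 1 $ 1 - v $ 4 * (K $ 1 $ 2 + K $ 2 $ 1) / 2 + v $ 3 * (K $ 2 $ 2 + (K $ 1 $ 3 + K $ 3 $ 1) / 2)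
     - v $ 2 * (K $ 2 $ 3 + K $ 3 $ 2) / 2 + v $ 1 * K $ 3 $ 3" for v
    by (simp add: trace_def sum_3 matrix_matrix_mult_def gram_def field_simps)
  note tr = this[of "axis 1 1"] this[of "axis 2 1"] this[of "axis 3 1"] this[of "axis 4 1"] this[of "axis 5 1"]
  have "K $ i $ j = K $ j $ i" for i j
    using arg_cong[OF assms(2), of "\<lambda>M. M $ i $ j"] by (simp add: transpose_def)
  from this[of 2 1] this[of 3 1] this[of 3 2] show ?thesis
    using tr assms(1) by (simp add: axis_def vec_eq_iff forall_3 Om_def)
qed

text \<open>The invariant quadratic form on \<open>V\<close>. Its invariance under \<open>A\<close> up to \<open>k\<^sup>2\<close> determines \<open>k\<close> from
  \<open>det A\<close>, without computing the determinant of the symmetric square.\<close>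

definition NF :: "real^5^5" where
  "NF = (\<chi> i j. if i = 3 \<and> j = 3 then 3/2 else if i = 1 \<and> j = 5 \<or> i = 5 \<and> j = 1 then 1
     else if i = 2 \<and> j = 4 \<or> i = 4 \<and> j = 2 then - 1/2 else 0)"

lemma trace_gram_Om_square: "trace (gram v ** Om ** gram v ** Om) = v \<bullet> (NF *v v)"
  by (simp add: trace_def sum_3 sum_5 matrix_matrix_mult_def matrix_vector_mult_def inner_vec_def
     gram_def Om_def NF_def field_simps)

lemma transpose_NF: "transpose NF = NF"
  by (auto simp: vec_eq_iff transpose_def NF_def)

text \<open>Nondegeneracy is read off from the kernel instead of expanding a determinant of size
  five.\<close>

lemma det_NF: "det NF \<noteq> 0"
proof -
  have "v = 0" if "NF *v v = 0" for v
  proof -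
    have "(NF *v v) $ i = 0" for i using that by simp
    from this[of 1] this[of 2] this[of 3] this[of 4] this[of 5] show ?thesis
      by (simp add: vec_eq_iff forall_5 matrix_vector_mult_def sum_5 NF_def)
  qed
  then show ?thesis using det_0_iff_kernel[of NF] by blast
qed

text \<open>By cyclicity of the trace, \<open>K\<close> annihilates every \<open>gram v\<close>,
  because \<open>Om\<close> annihilates every \<open>gram (A *v v)\<close>. So \<open>K\<close> is a
  multiple of \<open>Om\<close>, and it remains to show that the factor \<open>k\<close> is
  1.\<close>

lemma gram_isometry:
  assumes "det A = 1" "det C \<noteq> 0" and gram: "\<And>v. gram (A *v v) = transpose C ** gram v ** C"
  shows "C ** Om ** transpose C = Om"
proof -
  define K where "K = C ** Om ** transpose C"
  have "trace (gram v ** K) = 0" for v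
  proof -
    have "trace (gram v ** K) = trace (transpose C ** (gram v ** C ** Om))"
      by (subst trace_mul_sym) (simp add: K_def matrix_mul_assoc)
    also have "\<dots> = trace (gram (A *v v) ** Om)"
      by (simp add: gram matrix_mul_assoc)
    also have "\<dots> = 0"
      by (simp add: trace_def sum_3 matrix_matrix_mult_def gram_def Om_def)
    finally show ?thesis .
  qed
  moreover have "transpose K = K"
    by (simp add: K_def matrix_transpose_mul transpose_Om matrix_mul_assoc)
  ultimately obtain k where K: "K = k *\<^sub>R Om"
    using trace_gram_eq_0_imp by blast
  \<comment> \<open>The odd dimension of \<open>W\<close> yields the sign of
    \<open>k\<close>.\<close>
  have "k ^ 3 = det C ^ 2"
    using arg_cong[OF K, of det] by (simp add: K_def det_mul det_scaleR det_Om power2_eq_square)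
  then have "k ^ 3 > 0" using \<open>det C \<noteq> 0\<close> by simp
  then have "k > 0" by (simp add: zero_less_power_eq)
  \<comment> \<open>The form \<open>NF\<close> is quadratic in \<open>Om\<close>, hence the factor
    \<open>k ^ 2\<close>.\<close>
  have "transpose A ** NF ** A = (k ^ 2) *\<^sub>R NF"
  proof (rule symmetric_matrix_eqI)
    fix v
    have "(A *v v) \<bullet> (NF *v (A *v v)) = trace (transpose C ** (gram v ** C ** Om ** transpose C ** gram v ** C ** Om))"
      by (simp add: gram matrix_mul_assoc flip: trace_gram_Om_square)
    also have "\<dots> = trace (gram v ** K ** gram v ** K)"
      by (subst trace_mul_sym) (simp add: K_def matrix_mul_assoc)
    also have "\<dots> = k ^ 2 * trace (gram v ** Om ** gram v ** Om)"
      unfolding K by (simp add: trace_def sum_3 matrix_scalar_ac power2_eq_square algebra_simps flip: scalar_matrix_assoc)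
    finally have "(A *v v) \<bullet> (NF *v (A *v v)) = k ^ 2 * (v \<bullet> (NF *v v))"
      by (simp add: trace_gram_Om_square)
    then show "v \<bullet> (transpose A ** NF ** A *v v) = v \<bullet> (k\<^sup>2 *\<^sub>R NF *v v)"
      by (simp add: inner_transpose scaleR_matrix_vector_assoc[symmetric] flip: matrix_vector_mul_assoc del: transpose_matrix_vector)
  qed (simp_all add: matrix_transpose_mul transpose_NF transpose_scalar matrix_mul_assoc)
  \<comment> \<open>Determinants in dimension five give \<open>k ^ 10 = 1\<close>, and
    \<open>k\<close> is positive.\<close>
  from arg_cong[OF this, of det] have "(k ^ 2) ^ 5 = 1"
    using det_NF by (simp add: det_mul det_scaleR \<open>det A = 1\<close>)
  then have "k = 1"
    using \<open>k > 0\<close> power_eq_1_iff[of "k^2" 5] power_eq_1_iff[of k 2]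
    by (simp add: power_mult[symmetric] power_eq_1_iff)
  then show ?thesis using K by (simp add: K_def)
qed

text \<open>In odd dimension the determinant \<open>e\<close> of an isometry is an eigenvalue:
  determinants in the identity for \<open>D\<close> give
  \<open>det D * e = (- e) ^ 3 * det D\<close>, and since \<open>e\<close> is 1 or -1 this forces
  \<open>det D = 0\<close>.\<close>

lemma isometry_eigenvector:
  assumes "C ** Om ** transpose C = Om"
  obtains x e where "x \<noteq> 0" "C *v x = e *\<^sub>R x" "e ^ 2 = (1::real)"
proof -
  define e where "e = det C"
  have e: "e ^ 2 = 1"
    using arg_cong[OF assms, of det] by (simp add: det_mul det_Om e_def power2_eq_square)
  define D where "D = C - e *\<^sub>R mat 1"
  have "D ** Om ** transpose C = (- e) *\<^sub>R (Om ** transpose D)"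
  proof -
    have "D ** Om ** transpose C = C ** Om ** transpose C - e *\<^sub>R (Om ** transpose C)"
      by (simp add: D_def vec_eq_iff forall_3 sum_3 matrix_matrix_mult_def mat_def algebra_simps)
    also have "\<dots> = e ^ 2 *\<^sub>R Om - e *\<^sub>R (Om ** transpose C)"
      by (simp add: assms e)
    also have "\<dots> = (- e) *\<^sub>R (Om ** transpose D)"
      by (simp add: D_def vec_eq_iff forall_3 sum_3 matrix_matrix_mult_def mat_def transpose_def
          algebra_simps power2_eq_square)
    finally show ?thesis .
  qed
  from arg_cong[OF this, of det] have "det D * e = (- e) ^ 3 * det D"
    unfolding det_mul det_scaleR det_transpose det_Om e_def[symmetric] by simp
  moreover have "e = 1 \<or> e = -1" using e by (simp add: power2_eq_1_iff)
  ultimately have "det D = 0" by auto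
  then obtain x where x: "x \<noteq> 0" "D *v x = 0" using det_0_iff_kernel by blast
  then have "C *v x = e *\<^sub>R x"
    by (simp add: D_def matrix_vector_mult_diff_rdistrib scaleR_matrix_vector_assoc[symmetric])
  with x(1) e that show ?thesis by blast
qed

lemma W_preserving_fixed_point:
  assumes "det A = 1" and W: "\<And>X. X \<in> W \<Longrightarrow> act A X \<in> W"
  obtains v where "v \<noteq> 0" "A *v v = v"
proof -
  obtain C where C: "det C \<noteq> 0" "\<And>v. gram (A *v v) = transpose C ** gram v ** C"
    using gram_congruence[OF assms] by blast
  obtain x e where x: "x \<noteq> 0" "C *v x = e *\<^sub>R x" "e ^ 2 = 1"
    using isometry_eigenvector[OF gram_isometry[OF assms(1) C]] by blast
  \<comment> \<open>The covector obtained by evaluating \<open>gram v\<close> at \<open>x\<close>.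
    Its first and last entries detect \<open>x $ 3\<close> and \<open>x $ 1\<close>; if both vanish,
    the middle entry detects \<open>x $ 2\<close>.\<close>
  define u :: "real^5" where "u = (\<chi> i. if i = 1 then x $ 3 * x $ 3 else if i = 2 then - x $ 2 * x $ 3
    else if i = 3 then x $ 2 * x $ 2 + x $ 1 * x $ 3 else if i = 4 then - x $ 1 * x $ 2 else x $ 1 * x $ 1)"
  have u: "u \<bullet> v = x \<bullet> (gram v *v x)" for v
    by (simp add: u_def inner_vec_def sum_3 sum_5 gram_def matrix_vector_mult_def algebra_simps)
  have "u \<noteq> 0"
    using x(1) by (auto simp: u_def vec_eq_iff forall_3 forall_5)
  have "u \<bullet> (A *v v) = u \<bullet> v" for v
  proof -
    have "u \<bullet> (A *v v) = (C *v x) \<bullet> (gram v *v (C *v x))"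
      by (simp only: u C(2) inner_transpose flip: matrix_vector_mul_assoc)
    also have "\<dots> = e ^ 2 * (u \<bullet> v)"
      by (simp add: x(2) u matrix_vector_mult_scaleR power2_eq_square)
    finally show ?thesis using x(3) by simp
  qed
  then have "(transpose (A - mat 1) *v u) \<bullet> v = 0" for v
    by (simp add: inner_commute[of _ v] inner_transpose matrix_vector_mult_diff_rdistrib inner_diff_left
       inner_commute[of u] del: transpose_matrix_vector)
  then have "transpose (A - mat 1) *v u = 0" by (metis inner_eq_zero_iff)
  \<comment> \<open>The determinant transfers the eigenvalue 1 from the transpose to
    \<open>A\<close> itself.\<close>
  then have "det (transpose (A - mat 1)) = 0" using \<open>u \<noteq> 0\<close> det_0_iff_kernel by blast
  then obtain v where "v \<noteq> 0" "(A - mat 1) *v v = 0" 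
    using det_0_iff_kernel[of "A - mat 1"] by auto
  then show ?thesis using that by (simp add: matrix_vector_mult_diff_rdistrib)
qed

section \<open>Discrete spanning subgroups\<close>

lemma Ints_det:
  fixes M :: "real^'n^'n"
  assumes "\<And>i j. M $ i $ j \<in> \<int>"
  shows "det M \<in> \<int>"
  unfolding det_def by (intro Ints_sum Ints_mult Ints_prod assms) simp_all

lemma det_of_rat:
  fixes M :: "rat^'n^'n"
  shows "det (\<chi> i j. of_rat (M $ i $ j) :: real^'n^'n) = of_rat (det M)"
  by (simp add: det_def of_rat_sum of_rat_mult of_rat_prod)

lemma common_denominator:
  fixes y :: "rat^'n"
  obtains d :: int where "d > 0" "\<And>i. of_int d * y $ i \<in> \<int>"
proof
  let ?d = "\<Prod>i\<in>UNIV. snd (quotient_of (y $ i))"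
  show "?d > 0" by (intro prod_pos) (simp add: quotient_of_denom_pos')
  show "of_int ?d * y $ i \<in> \<int>" for i
  proof -
    have "of_int (snd (quotient_of (y $ i))) * y $ i = of_int (fst (quotient_of (y $ i)))"
      using quotient_of_div[of "y $ i" "fst (quotient_of (y $ i))" "snd (quotient_of (y $ i))"]
        quotient_of_denom_pos'[of "y $ i"] by (simp add: field_simps)
    moreover have "?d = (\<Prod>j\<in>UNIV - {i}. snd (quotient_of (y $ j))) * snd (quotient_of (y $ i))"
      by (subst prod.remove[of UNIV i]) simp_all
    ultimately have "of_int ?d * y $ i = of_int ((\<Prod>j\<in>UNIV - {i}. snd (quotient_of (y $ j))) * fst (quotient_of (y $ i)))"
      by (simp add: mult.assoc)
    then show ?thesis by (metis Ints_of_int)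
  qed
qed

text \<open>Closure under differences turns isolation of 0 into uniform discreteness. Hence
  \<open>L\<close> is closed and meets a closed ball in a compact discrete set.\<close>

lemma discrete_additive_finite:
  fixes L :: "'a::euclidean_space set"
  assumes diff: "\<And>x y. x \<in> L \<Longrightarrow> y \<in> L \<Longrightarrow> x - y \<in> L"
    and discr: "e > 0" "\<And>x. x \<in> L \<Longrightarrow> norm x < e \<Longrightarrow> x = 0"
    and "bounded S"
  shows "finite (L \<inter> S)"
proof -
  have ud: "uniform_discrete L"
    unfolding uniform_discrete_def
    using discr diff by (metis dist_norm right_minus_eq)
  obtain r where r: "S \<subseteq> cball 0 r"
    using bounded_subset_ballD[OF \<open>bounded S\<close>, of 0] ball_subset_cball by blast
  have "compact (L \<inter> cball 0 r)"
    by (intro closed_Int_compact uniform_discrete_imp_closed ud compact_cball)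
  moreover have "discrete (L \<inter> cball 0 r)"
    by (rule uniform_discrete_imp_discrete) (use ud in \<open>auto simp: uniform_discrete_def\<close>)
  ultimately have "finite (L \<inter> cball 0 r)"
    using discrete_compact_finite_iff by blast
  then show ?thesis by (rule rev_finite_subset) (use r in auto)
qed

text \<open>\<open>\<phi>\<close> gives coordinates in which \<open>\<int>\<^sup>n \<subseteq> L \<subseteq> (1/m) \<int>\<^sup>n\<close>. This is weaker than the existence of a
  lattice basis, but suffices for determinants and rationality.\<close>

locale lattice_coordinates =
  fixes L :: "(real^'n) set" and \<phi> P :: "real^'n \<Rightarrow> real^'n" and m :: nat
  assumes linear_\<phi>: "linear \<phi>" and linear_P: "linear P"
    and \<phi>_P: "\<And>x. \<phi> (P x) = x" and P_\<phi>: "\<And>x. P (\<phi> x) = x"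
    and m_pos: "m > 0"
    and basis: "\<And>i. P (axis i 1) \<in> L"
    and coords: "\<And>l i. l \<in> L \<Longrightarrow> real m * \<phi> l $ i \<in> \<int>"

text \<open>The denominators are bounded by the pigeonhole principle: two of the multiples \<open>0, l, 2 l, \<dots>\<close>
  agree modulo the real basis, since \<open>L\<close> meets its fundamental cube in a finite set.\<close>

lemma lattice_coordinates_exist:
  fixes L :: "(real^'n) set"
  assumes diff: "\<And>x y. x \<in> L \<Longrightarrow> y \<in> L \<Longrightarrow> x - y \<in> L"
    and discr: "e > 0" "\<And>x. x \<in> L \<Longrightarrow> norm x < e \<Longrightarrow> x = 0"
    and span: "span L = UNIV"
  obtains \<phi> P m where "lattice_coordinates L \<phi> P m"
proof -
  obtain B where B: "B \<subseteq> L" "independent B" "L \<subseteq> span B"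
    using maximal_independent_subset by blast
  have spanB: "span B = UNIV"
    using span span_mono[OF B(3)] by (metis span_span top.extremum_uniqueI)
  have "card B = CARD('n)"
    using dim_eq_card[OF _ B(2), of UNIV] spanB by simp
  moreover have "finite B" using B(2) by (rule independent_imp_finite)
  ultimately obtain f :: "'n \<Rightarrow> real^'n" where f: "bij_betw f UNIV B"
    using bij_betw_iff_card[of "UNIV::'n set" B] by auto
  define P where "P x = (\<Sum>i\<in>UNIV. x $ i *\<^sub>R f i)" for x :: "real^'n"
  have linP: "linear P"
    by (rule linearI) (simp_all add: P_def scaleR_add_left sum.distrib scaleR_sum_right)
  have Paxis: "P (axis i 1) = f i" for i
  proof -
    have "P (axis i 1) = (\<Sum>j\<in>UNIV. if j = i then f j else 0)"
      unfolding P_def by (rule sum.cong) (auto simp: axis_def)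
    then show ?thesis by simp
  qed
  have "B \<subseteq> range P" using f Paxis by (metis bij_betw_imp_surj_on image_subset_iff rangeI)
  then have "span B \<subseteq> range P"
    by (intro span_minimal linear_subspace_image[OF linP] subspace_UNIV)
  then have "surj P" using spanB by blast
  then have "inj P" using linP by (metis linear_surjective_imp_injective)
  obtain \<phi> where \<phi>: "linear \<phi>" "\<phi> \<circ> P = id" "P \<circ> \<phi> = id"
    using linear_surjective_isomorphism[OF linP \<open>surj P\<close>] by (auto simp: o_def fun_eq_iff)
  have \<phi>P: "\<phi> (P x) = x" and P\<phi>: "P (\<phi> x) = x" for x
    using \<phi> by (auto simp: o_def fun_eq_iff)
  have fL: "f i \<in> L" for i using f B(1) by (auto simp: bij_betw_def)
  then have "0 \<in> L" using diff[of "f undefined" "f undefined"] by simp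
  then have neg: "- x \<in> L" if "x \<in> L" for x using diff[of 0 x] that by simp
  then have add: "x + y \<in> L" if "x \<in> L" "y \<in> L" for x y using diff[of x "- y"] that by simp
  have nat: "real k *\<^sub>R x \<in> L" if "x \<in> L" for k x
    by (induction k) (use \<open>0 \<in> L\<close> add that in \<open>simp_all add: scaleR_add_left\<close>)
  have int: "of_int k *\<^sub>R x \<in> L" if "x \<in> L" for k x
    by (cases k rule: int_cases2) (use nat neg that in simp_all)
  have sum: "sum g S \<in> L" if "finite S" "\<And>i. i \<in> S \<Longrightarrow> g i \<in> L" for g and S :: "'n set"
    using that by (induction S) (use \<open>0 \<in> L\<close> add in simp_all)
  \<comment> \<open>The points of \<open>L\<close> in the closed fundamental cube of the basis
    \<open>f\<close>.\<close>
  define F where "F = L \<inter> P ` {x. \<forall>i. 0 \<le> x $ i \<and> x $ i \<le> 1}"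
  have "bounded {x::real^'n. \<forall>i. 0 \<le> x $ i \<and> x $ i \<le> 1}"
    by (rule bounded_subset[OF bounded_cbox[of 0 "\<chi> i. 1"]]) (auto simp: mem_box_cart)
  then have "bounded (P ` {x. \<forall>i. 0 \<le> x $ i \<and> x $ i \<le> 1})"
    by (rule bounded_linear_image) (rule linear_conv_bounded_linear[THEN iffD1, OF linP])
  then have "finite F"
    unfolding F_def using discrete_additive_finite[of L e] diff discr by blast
  \<comment> \<open>The factorial is divisible by every difference of indices up to
    \<open>card F\<close>, so one \<open>m\<close> serves all \<open>l\<close> and all
    coordinates.\<close>
  define m where "m = (fact (card F) :: nat)"
  have "real m * \<phi> l $ i \<in> \<int>" if "l \<in> L" for l i
  proof -
    \<comment> \<open>The representative of the multiple \<open>k l\<close> in the cube, modulo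
      integer combinations of the \<open>f i\<close>.\<close>
    define r where "r k = P (\<chi> i. frac (real k * \<phi> l $ i))" for k
    have "r k \<in> F" for k
    proof -
      have "P (\<chi> i. frac (real k * \<phi> l $ i)) = P (real k *\<^sub>R \<phi> l - (\<chi> i. of_int \<lfloor>real k * \<phi> l $ i\<rfloor>))"
        by (rule arg_cong[of _ _ P]) (simp add: vec_eq_iff frac_def)
      then have "r k = real k *\<^sub>R l - (\<Sum>i\<in>UNIV. of_int \<lfloor>real k * \<phi> l $ i\<rfloor> *\<^sub>R f i)"
        by (simp add: r_def linear_diff[OF linP] linear_scale[OF linP] P\<phi>) (simp add: P_def)
      then have "r k \<in> L"
        by (simp only:) (intro diff nat \<open>l \<in> L\<close> sum int fL finite)
      then show ?thesis
        by (auto simp: F_def r_def frac_ge_0 less_imp_le[OF frac_lt_1])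
    qed
    then have "r ` {0..card F} \<subseteq> F" by blast
    then have "card (r ` {0..card F}) < card {0..card F}"
      using card_mono[OF \<open>finite F\<close>] by (metis Suc_eq_plus1 card_atLeastAtMost diff_zero less_Suc_eq_le)
    then obtain a b where ab: "a \<le> card F" "b \<le> card F" "a < b" "r a = r b"
      using pigeonhole[of r "{0..card F}"] by (auto simp: inj_on_def) (metis nat_neq_iff)
    have "frac (real a * \<phi> l $ i) = frac (real b * \<phi> l $ i)"
      using arg_cong[OF ab(4), of "\<lambda>x. \<phi> x $ i"] by (simp add: r_def \<phi>P)
    then have "real (b - a) * \<phi> l $ i = of_int (\<lfloor>real b * \<phi> l $ i\<rfloor> - \<lfloor>real a * \<phi> l $ i\<rfloor>)"
      using ab(3) by (simp add: frac_def of_nat_diff algebra_simps)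
    then have "real (b - a) * \<phi> l $ i \<in> \<int>" by (metis Ints_of_int)
    moreover have "(b - a) dvd m"
      unfolding m_def using ab by (intro dvd_fact) auto
    then obtain q where "m = (b - a) * q" by blast
    then have "real m * \<phi> l $ i = real q * (real (b - a) * \<phi> l $ i)" by simp
    ultimately show ?thesis by (metis Ints_mult Ints_of_nat)
  qed
  moreover have "m > 0" by (simp add: m_def)
  ultimately have "lattice_coordinates L \<phi> P m"
    by (intro lattice_coordinates.intro) (use \<phi> linP \<phi>P P\<phi> Paxis fL in simp_all)
  then show ?thesis by (rule that)
qed

section \<open>Linear maps preserving a lattice\<close>

context lattice_coordinates
begin

text \<open>The number multiplied by \<open>m\<close> is the entry \<open>(i, j)\<close> of the
  matrix of \<open>g\<close> in the coordinates \<open>\<phi>\<close>.\<close>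

lemma coords_conj:
  assumes "g ` L \<subseteq> L"
  shows "real m * \<phi> (g (P (axis j 1))) $ i \<in> \<int>"
  using assms basis by (intro coords) blast

lemma det_conj:
  assumes "linear g"
  shows "det (matrix (\<phi> \<circ> g \<circ> P)) = det (matrix g)"
proof -
  have "matrix \<phi> ** matrix P = mat 1"
    using matrix_compose[OF linear_P linear_\<phi>] \<phi>_P by (simp add: o_def matrix_id_mat_1 flip: id_def)
  then have "det (matrix \<phi>) * det (matrix P) = 1" by (metis det_I det_mul)
  moreover have "matrix (\<phi> \<circ> g \<circ> P) = matrix \<phi> ** matrix g ** matrix P"
    using linear_P linear_\<phi> assms by (simp add: matrix_compose linear_compose)
  ultimately show ?thesis by (simp add: det_mul)
qed

lemma det_Ints:
  assumes "linear g" "g ` L \<subseteq> L"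
  shows "real m ^ CARD('n) * det (matrix g) \<in> \<int>"
proof -
  have "real m ^ CARD('n) * det (matrix g) = det (\<chi> i. real m *s matrix (\<phi> \<circ> g \<circ> P) $ i)"
    by (simp add: det_rows_mul det_conj[OF assms(1)])
  also have "\<dots> \<in> \<int>"
    by (rule Ints_det) (use coords_conj[OF assms(2)] in \<open>simp add: matrix_def\<close>)
  finally show ?thesis .
qed

text \<open>The determinants of the powers of \<open>g\<close> lie in the discrete group \<open>m\<^bsup>-n\<^esup> \<int>\<close>.\<close>

lemma abs_det_ge_1:
  assumes g: "linear g" "g ` L \<subseteq> L" and nz: "det (matrix g) \<noteq> 0"
  shows "\<bar>det (matrix g)\<bar> \<ge> 1"
proof (rule ccontr)
  assume "\<not> 1 \<le> \<bar>det (matrix g)\<bar>"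
  moreover have "1 / real m ^ CARD('n) > 0" using m_pos by simp
  ultimately obtain k where k: "\<bar>det (matrix g)\<bar> ^ k < 1 / real m ^ CARD('n)"
    by (metis not_le real_arch_pow_inv)
  have pow: "linear (g ^^ k) \<and> (g ^^ k) ` L \<subseteq> L \<and> det (matrix (g ^^ k)) = det (matrix g) ^ k"
  proof (induction k)
    case 0
    show ?case
      unfolding funpow.simps(1) power_0 by (intro conjI linear_id matrix_id) simp
  next
    case (Suc k)
    then have IH: "linear (g ^^ k)" "(g ^^ k) ` L \<subseteq> L" "det (matrix (g ^^ k)) = det (matrix g) ^ k"
      by auto
    show ?case
      unfolding funpow.simps(2)
    proof (intro conjI)
      show "linear (g \<circ> g ^^ k)" using IH(1) g(1) by (rule linear_compose)
      show "(g \<circ> g ^^ k) ` L \<subseteq> L" using IH(2) g(2) by fastforce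
      show "det (matrix (g \<circ> g ^^ k)) = det (matrix g) ^ Suc k"
        unfolding matrix_compose[OF IH(1) g(1)] det_mul IH(3) by simp
    qed
  qed
  obtain z where z: "real m ^ CARD('n) * det (matrix (g ^^ k)) = of_int z"
    using det_Ints pow by (metis Ints_cases)
  have "z \<noteq> 0" using z nz m_pos pow by auto
  then have "1 \<le> \<bar>real m ^ CARD('n) * det (matrix (g ^^ k))\<bar>" unfolding z by linarith
  also have "\<dots> = real m ^ CARD('n) * \<bar>det (matrix g)\<bar> ^ k"
    using pow by (simp add: abs_mult power_abs)
  also have "\<dots> < 1" using k m_pos by (simp add: field_simps)
  finally show False by simp
qed

text \<open>Since \<open>L\<close> contains a basis, \<open>g\<close> is onto; its inverse also
  preserves \<open>L\<close>, so the lower bound \<open>abs_det_ge_1\<close> applies to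
  both.\<close>

lemma abs_det_eq_1:
  assumes g: "linear g" "g ` L = L"
  shows "\<bar>det (matrix g)\<bar> = 1"
proof -
  have "range g \<supseteq> range P"
  proof -
    have "span (range (\<lambda>i. P (axis i 1))) \<subseteq> range g"
      by (intro span_minimal linear_subspace_image[OF g(1)] subspace_UNIV) (use basis g(2) in blast)
    moreover have "P x \<in> span (range (\<lambda>i. P (axis i 1)))" for x
    proof -
      have "P x = P (\<Sum>i\<in>UNIV. x $ i *\<^sub>R axis i 1)"
        by (simp add: basis_expansion flip: scalar_mult_eq_scaleR)
      also have "\<dots> = (\<Sum>i\<in>UNIV. x $ i *\<^sub>R P (axis i 1))"
        by (simp add: linear_sum[OF linear_P] linear_scale[OF linear_P])
      also have "\<dots> \<in> span (range (\<lambda>i. P (axis i 1)))"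
        by (intro span_sum span_scale span_base) blast
      finally show ?thesis .
    qed
    ultimately show ?thesis by blast
  qed
  moreover have "range P = UNIV" using P_\<phi> by (metis surjI)
  ultimately have "surj g" by blast
  obtain h where h: "linear h" "g \<circ> h = id" "h \<circ> g = id"
    using linear_surjective_isomorphism[OF g(1) \<open>surj g\<close>] by (auto simp: o_def fun_eq_iff)
  have "h ` L = h ` g ` L" by (simp add: g(2))
  also have "\<dots> = L" using h(3) by (simp add: image_comp)
  finally have hL: "h ` L \<subseteq> L" by simp
  have "det (matrix g) * det (matrix h) = 1"
    using matrix_compose[OF h(1) g(1)] h(2) by (metis det_I det_mul matrix_id_mat_1)
  then have nz: "det (matrix g) \<noteq> 0" "det (matrix h) \<noteq> 0" and
    prod: "\<bar>det (matrix g)\<bar> * \<bar>det (matrix h)\<bar> = 1"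
    by (auto simp flip: abs_mult)
  have "\<bar>det (matrix g)\<bar> \<ge> 1" "\<bar>det (matrix h)\<bar> \<ge> 1"
    using abs_det_ge_1[OF g(1)] abs_det_ge_1[OF h(1) hL] g(2) nz by auto
  then show ?thesis
    using prod by (smt (verit) mult_less_cancel_left2 mult_le_cancel_left1)
qed

text \<open>In the coordinates \<open>\<phi>\<close> the map has rational entries, so the integer
  eigenvalue \<open>c\<close> also has a rational eigenvector of the transpose. Clearing
  denominators makes it integral.\<close>

lemma rational_invariant_covector:
  assumes g: "linear g" "g ` L \<subseteq> L" and v: "v \<noteq> 0" "g v = of_int c *\<^sub>R v"
  obtains \<xi> where "\<xi> \<noteq> 0" "\<And>l. l \<in> L \<Longrightarrow> \<xi> \<bullet> l \<in> \<int>" "\<And>x. \<xi> \<bullet> g x = of_int c * (\<xi> \<bullet> x)"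
proof -
  define M where "M = matrix (\<phi> \<circ> g \<circ> P)"
  have M: "M *v x = \<phi> (g (P x))" for x
    using matrix_works[of "\<phi> \<circ> g \<circ> P"] linear_P linear_\<phi> g(1) by (simp add: M_def linear_compose)
  have "M $ i $ j \<in> \<rat>" for i j
  proof -
    have "real m * M $ i $ j \<in> \<int>"
      using coords_conj[OF g(2)] by (simp add: M_def matrix_def)
    then have "real m * M $ i $ j / real m \<in> \<rat>"
      by (intro Rats_divide Rats_of_nat) (use Ints_subset_Rats in blast)
    then show ?thesis using m_pos by simp
  qed
  then have "\<exists>q. M $ i $ j = of_rat q" for i j by (metis Rats_cases)
  then obtain q where q: "\<And>i j. M $ i $ j = of_rat (q i j)" by metis
  define N :: "rat^'n^'n" where "N = (\<chi> i j. q i j - (if i = j then of_int c else 0))"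
  have N: "(\<chi> i j. of_rat (N $ i $ j)) = M - mat (of_int c)"
    by (simp add: N_def vec_eq_iff mat_def q of_rat_diff)
  have "mat (of_int c) *v x = of_int c *\<^sub>R x" for x :: "real^'n"
    by (simp add: vec_eq_iff matrix_vector_mult_def mat_def if_distrib if_distribR cong: if_cong)
  then have "(M - mat (of_int c)) *v \<phi> v = 0"
    by (simp add: matrix_vector_mult_diff_rdistrib M P_\<phi> v(2) linear_scale[OF linear_\<phi>])
  moreover have "\<phi> v \<noteq> 0" using v(1) P_\<phi>[of v] linear_0[OF linear_P] by metis
  ultimately have "det (M - mat (of_int c)) = 0" using det_0_iff_kernel by blast
  \<comment> \<open>The determinant of a rational matrix is the same over both fields, so
    singularity descends to the rationals.\<close>
  then have "det (transpose N) = 0"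
    using det_of_rat[of N] by (simp add: N)
  then obtain y where y: "y \<noteq> 0" "transpose N *v y = 0" using det_0_iff_kernel by blast
  obtain d where d: "d > 0" "\<And>i. of_int d * y $ i \<in> \<int>" using common_denominator by blast
  define \<eta> :: "real^'n" where "\<eta> = (\<chi> i. of_int d * of_rat (y $ i))"
  have \<eta>_Ints: "\<eta> $ i \<in> \<int>" for i
  proof -
    obtain k where "of_int d * y $ i = of_int k" using d(2) by (metis Ints_cases)
    then have "(of_rat (of_int d * y $ i) :: real) = of_int k" by simp
    then have "\<eta> $ i = of_int k" by (simp add: \<eta>_def of_rat_mult)
    then show ?thesis by simp
  qed
  have "\<eta> \<noteq> 0" using y(1) d(1) by (auto simp: \<eta>_def vec_eq_iff)
  have "\<eta> \<bullet> ((M - mat (of_int c)) *v x) = 0" for x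
  proof -
    have "(transpose (M - mat (of_int c)) *v \<eta>) $ j = 0" for j
    proof -
      have "(transpose (M - mat (of_int c)) *v \<eta>) $ j = of_int d * of_rat ((transpose N *v y) $ j)"
        unfolding N[symmetric]
        by (simp add: matrix_vector_mult_def transpose_def \<eta>_def of_rat_sum of_rat_mult sum_distrib_left
            mult.left_commute del: transpose_matrix_vector)
      then show ?thesis by (simp only: y(2)) simp
    qed
    then have "transpose (M - mat (of_int c)) *v \<eta> = 0" by (simp add: vec_eq_iff del: transpose_matrix_vector)
    then have "x \<bullet> (transpose (M - mat (of_int c)) *v \<eta>) = 0" by simp
    then show ?thesis
      by (simp add: inner_transpose inner_commute del: transpose_matrix_vector)
  qed
  then have \<eta>M: "\<eta> \<bullet> \<phi> (g (P x)) = of_int c * (\<eta> \<bullet> x)" for x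
    using \<open>\<And>x. mat (of_int c) *v x = of_int c *\<^sub>R x\<close>
    by (simp add: matrix_vector_mult_diff_rdistrib M inner_diff_right)
  \<comment> \<open>The pullback of \<open>\<eta>\<close> to the original coordinates; the factor
    \<open>m\<close> absorbs the denominators of points of \<open>L\<close>.\<close>
  define \<xi> where "\<xi> = adjoint \<phi> (real m *\<^sub>R \<eta>)"
  have \<xi>: "\<xi> \<bullet> x = real m * (\<eta> \<bullet> \<phi> x)" for x
    using adjoint_works[OF linear_\<phi>, of x "real m *\<^sub>R \<eta>"] by (simp add: \<xi>_def inner_commute)
  show ?thesis
  proof (rule that)
    have "\<xi> \<bullet> P \<eta> \<noteq> 0" using \<open>\<eta> \<noteq> 0\<close> m_pos by (simp add: \<xi> \<phi>_P)
    then show "\<xi> \<noteq> 0" by auto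
    show "\<xi> \<bullet> g x = of_int c * (\<xi> \<bullet> x)" for x
      using \<eta>M[of "\<phi> x"] by (simp add: \<xi> P_\<phi>)
    show "\<xi> \<bullet> l \<in> \<int>" if "l \<in> L" for l
    proof -
      have "\<xi> \<bullet> l = (\<Sum>i\<in>UNIV. \<eta> $ i * (real m * \<phi> l $ i))"
        unfolding \<xi> by (simp add: inner_vec_def sum_distrib_left mult.left_commute)
      also have "\<dots> \<in> \<int>"
        by (intro Ints_sum Ints_mult \<eta>_Ints coords[OF that])
      finally show ?thesis .
    qed
  qed
qed

end

section \<open>Automorphisms and lattices of the nilpotent group\<close>

lemma Aut_mult:
  assumes "\<tau> \<in> Aut"
  shows "\<tau> (x \<otimes>\<^bsub>nilG\<^esub> y) = \<tau> x \<otimes>\<^bsub>nilG\<^esub> \<tau> y"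
proof -
  interpret group_hom nilG nilG \<tau>
    using assms by unfold_locales (auto simp: Aut_def iso_def)
  show ?thesis by (rule hom_mult) simp_all
qed

lemma Aut_bracket:
  assumes "\<tau> \<in> Aut"
  shows "\<tau> (bracket x y) = bracket (\<tau> x) (\<tau> y)"
  unfolding commutator_nilG[symmetric]
  by (simp only: Aut_mult[OF assms] inv_nilG linear_neg[OF Aut_linear[OF assms]])

lemma act_Wedge2: "X \<in> Wedge2 \<Longrightarrow> act A X \<in> Wedge2"
  unfolding Wedge2_eq by (simp add: act_def matrix_transpose_mul matrix_mul_assoc)
    (simp add: vec_eq_iff matrix_matrix_mult_def sum_negf)

text \<open>On brackets an automorphism acts through its factor, and brackets span the commutator
  subgroup. So it acts there as the exterior square of the factor, modulo \<open>W\<close>.\<close>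

lemma Aut_modW:
  assumes "\<tau> \<in> Aut" "X \<in> Wedge2"
  shows "\<tau> (0, modW X) = (0, modW (act (matrix (factor \<tau>)) X))"
proof -
  note lin = Aut_linear[OF assms(1)]
  have "X \<in> span {v \<^bold>\<and> w | v w. True}" using assms(2) by (simp add: Wedge2_def)
  then have "X \<in> Wedge2 \<and> \<tau> (0, modW X) = (0, modW (act (matrix (factor \<tau>)) X))"
  proof (induction rule: span_induct_alt)
    case base
    show ?case
      using linear_0[OF lin]
      by (simp add: linear_0[OF linear_act] modW_0 zero_prod_def subspace_0[OF subspace_Wedge2])
  next
    case (step c X Y)
    from step.hyps obtain a b where X: "X = a \<^bold>\<and> b" by blast
    have Y: "Y \<in> Wedge2" using step.IH by simp
    have wedge: "(0, modW (a \<^bold>\<and> b)) = bracket (a, 0) (b, 0)" by (simp add: bracket_def)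
    have f: "fst (\<tau> (v, 0)) = matrix (factor \<tau>) *v v" for v
      using fun_cong[OF matrix_vector_mul(2)[OF linear_factor[OF assms(1)]], of v] by (simp add: factor_def)
    have "\<tau> (0, modW X) = (0, modW (act (matrix (factor \<tau>)) X))"
      unfolding X wedge Aut_bracket[OF assms(1)] by (simp add: bracket_def f act_wedge)
    moreover have "((0, modW (c *\<^sub>R X + Y)) :: lie) = c *\<^sub>R (0, modW X) + (0, modW Y)"
      using Y by (simp add: X modW_add modW_scaleR subspace_scale[OF subspace_Wedge2])
    ultimately have "\<tau> (0, modW (c *\<^sub>R X + Y)) =
        c *\<^sub>R (0, modW (act (matrix (factor \<tau>)) X)) + (0, modW (act (matrix (factor \<tau>)) Y))"
      using step.IH by (simp only: linear_add[OF lin] linear_scale[OF lin])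
    then show ?case
      using Y
      by (simp add: linear_add[OF lin] linear_scale[OF lin] linear_add[OF linear_act] linear_scale[OF linear_act]
         modW_add modW_scaleR subspace_scale[OF subspace_Wedge2] subspace_add[OF subspace_Wedge2] X act_Wedge2)
  qed
  then show ?thesis ..
qed

text \<open>Elements of \<open>W\<close> represent 0 in the quotient and \<open>\<tau>\<close> fixes
  0, so their images must represent 0 as well.\<close>

lemma Aut_preserves_W:
  assumes "\<tau> \<in> Aut" "X \<in> W"
  shows "act (matrix (factor \<tau>)) X \<in> W"
proof -
  have X: "X \<in> Wedge2" using assms(2) W_subset by blast
  have modW_eq_0: "modW Y = 0 \<longleftrightarrow> Y \<in> W" if "Y \<in> Wedge2" for Y
    using modW_eq_iff[OF that subspace_0[OF subspace_Wedge2]] by (simp add: modW_0)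
  have "\<tau> (0, modW X) = 0"
    using modW_eq_0[OF X] assms(2) linear_0[OF Aut_linear[OF assms(1)]] by (simp add: zero_prod_def)
  then have "modW (act (matrix (factor \<tau>)) X) = 0"
    by (simp add: Aut_modW[OF assms(1) X] zero_prod_def)
  then show ?thesis using modW_eq_0[OF act_Wedge2[OF X]] by simp
qed

lemma factor_fixed_point:
  assumes "\<tau> \<in> Aut" "det (matrix (factor \<tau>)) = 1"
  obtains v where "v \<noteq> 0" "factor \<tau> v = v"
proof -
  obtain v where "v \<noteq> 0" "matrix (factor \<tau>) *v v = v"
    using W_preserving_fixed_point[OF assms(2) Aut_preserves_W[OF assms(1)]] by blast
  then show ?thesis
    using that fun_cong[OF matrix_vector_mul(2)[OF linear_factor[OF assms(1)]], of v] by simp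
qed

lemma Aut_compose:
  assumes "\<tau> \<in> Aut" "\<rho> \<in> Aut"
  shows "\<tau> \<circ> \<rho> \<in> Aut" "factor (\<tau> \<circ> \<rho>) = factor \<tau> \<circ> factor \<rho>"
proof -
  have "continuous_on UNIV (\<tau> \<circ> \<rho>)"
    using assms by (intro continuous_on_compose) (auto simp: Aut_def intro: continuous_on_subset)
  then show "\<tau> \<circ> \<rho> \<in> Aut"
    using assms iso_set_trans[of \<rho> nilG nilG \<tau> nilG] by (simp add: Aut_def)
  show "factor (\<tau> \<circ> \<rho>) = factor \<tau> \<circ> factor \<rho>"
    using factor_fst[OF assms(1)] by (simp add: fun_eq_iff factor_def)
qed

text \<open>The square of \<open>\<tau>\<close> has factor determinant 1, hence a fixed vector
  \<open>v\<close>. Either \<open>v\<close> is fixed already, or \<open>factor \<tau> v - v\<close>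
  is an eigenvector for -1.\<close>

lemma factor_eigenvalue:
  assumes "\<tau> \<in> Aut" "\<bar>det (matrix (factor \<tau>))\<bar> = 1"
  obtains v c where "v \<noteq> 0" "factor \<tau> v = of_int c *\<^sub>R v" "c = 1 \<or> c = -1"
proof -
  note lin = linear_factor[OF assms(1)]
  have "det (matrix (factor \<tau>)) ^ 2 = 1" using assms(2) power2_abs[of "det (matrix (factor \<tau>))"] by simp
  then have "det (matrix (factor (\<tau> \<circ> \<tau>))) = 1"
    by (simp add: Aut_compose[OF assms(1,1)] matrix_compose lin det_mul power2_eq_square)
  then obtain v where v: "v \<noteq> 0" "factor \<tau> (factor \<tau> v) = v"
    using factor_fixed_point[OF Aut_compose(1)[OF assms(1,1)]] Aut_compose(2)[OF assms(1,1)] by auto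
  show ?thesis
  proof (cases "factor \<tau> v = v")
    case True
    then show ?thesis using that[of v 1] v by simp
  next
    case False
    have "factor \<tau> (factor \<tau> v - v) = of_int (-1) *\<^sub>R (factor \<tau> v - v)"
      by (simp add: linear_diff[OF lin] v(2))
    then show ?thesis using that[of "factor \<tau> v - v" "-1"] False by simp
  qed
qed

text \<open>An eigenvalue of the quotient map is one of the whole map: \<open>h\<close> projects
  onto \<open>k\<close>, which is not surjective, so in finite dimension \<open>h\<close> is not
  injective.\<close>

lemma not_hyperbolic:
  assumes "\<tau> \<in> Aut" "v \<noteq> 0" "factor \<tau> v = of_int c *\<^sub>R v" "c = 1 \<or> c = -1"
  shows "\<not> hyperbolic \<tau>"
proof -
  let ?c = "of_int c :: real"
  define h where "h = (\<lambda>x. \<tau> x - ?c *\<^sub>R x)"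
  have lin: "linear h"
    unfolding h_def
    by (intro linear_compose_sub Aut_linear assms(1) linear_scale_self)
  define k where "k = (\<lambda>x. factor \<tau> x - ?c *\<^sub>R x)"
  have link: "linear k"
    unfolding k_def
    by (intro linear_compose_sub linear_factor assms(1) linear_scale_self)
  have fst: "fst (h x) = k (fst x)" for x
    by (simp add: h_def k_def factor_fst[OF assms(1)])
  have "\<not> inj k"
    using linear_injective_0[OF link] assms(2,3) by (auto simp: k_def)
  then have "\<not> surj k" using linear_surjective_imp_injective[OF link] by blast
  moreover have "surj k" if surj: "surj h"
    unfolding surj_def
  proof
    fix y
    obtain x where "(y, 0) = h x" using surj unfolding surj_def by blast
    then show "\<exists>x. y = k x" using fst[of x] by (intro exI[of _ "fst x"]) (metis fst_conv)
  qed
  ultimately have "\<not> surj h" by blast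
  then have "\<not> inj h" using linear_injective_imp_surjective[OF lin] by blast
  then obtain x where x: "x \<noteq> 0" "h x = 0" using linear_injective_0[OF lin] by blast
  then have "\<tau> x = ?c *\<^sub>R x" by (simp add: h_def)
  then have "complex_eigenvalue \<tau> (of_int c)"
    unfolding complex_eigenvalue_def using x(1) linear_0[OF Aut_linear[OF assms(1)]]
    by (intro exI[of _ x] exI[of _ 0]) simp
  then show ?thesis
    using assms(4) unfolding hyperbolic_def by (intro notI) (auto dest: spec[of _ "of_int c"])
qed

section \<open>The projection of a lattice to \<open>V\<close>\<close>

lemma coset_eq_fst:
  assumes "subgroup \<Gamma> nilG" "g <#\<^bsub>nilG\<^esub> \<Gamma> = h <#\<^bsub>nilG\<^esub> \<Gamma>"
  obtains l where "l \<in> fst ` \<Gamma>" "fst g = fst h + l"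
proof -
  have "0 \<in> \<Gamma>" using subgroup.one_closed[OF assms(1)] by simp
  then have "g \<in> g <#\<^bsub>nilG\<^esub> \<Gamma>" unfolding l_coset_def by (auto intro!: bexI[of _ 0])
  then have "g \<in> h <#\<^bsub>nilG\<^esub> \<Gamma>" using assms(2) by simp
  then obtain k where "k \<in> \<Gamma>" "g = h \<otimes>\<^bsub>nilG\<^esub> k" unfolding l_coset_def by blast
  then show ?thesis using that[of "fst k"] by simp
qed

lemma fst_subgroup_diff:
  assumes "subgroup \<Gamma> nilG" "x \<in> fst ` \<Gamma>" "y \<in> fst ` \<Gamma>"
  shows "x - y \<in> fst ` \<Gamma>"
proof -
  obtain a b where ab: "a \<in> \<Gamma>" "b \<in> \<Gamma>" "x = fst a" "y = fst b" using assms(2,3) by blast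
  have "a \<otimes>\<^bsub>nilG\<^esub> inv\<^bsub>nilG\<^esub> b \<in> \<Gamma>"
    using ab assms(1) by (intro subgroup.m_closed subgroup.m_inv_closed)
  moreover have "fst (a \<otimes>\<^bsub>nilG\<^esub> inv\<^bsub>nilG\<^esub> b) = x - y" by (simp add: inv_nilG ab)
  ultimately show ?thesis by (metis imageI)
qed

text \<open>Periodicity of \<open>Q\<close> under the projected lattice makes the condition
  independent of the representative of a coset.\<close>

lemma vimage_coset_set:
  assumes "subgroup \<Gamma> nilG" and Q: "\<And>v l. l \<in> fst ` \<Gamma> \<Longrightarrow> Q (v + l) \<Longrightarrow> Q v"
  shows "g <#\<^bsub>nilG\<^esub> \<Gamma> \<in> (\<lambda>g. g <#\<^bsub>nilG\<^esub> \<Gamma>) ` {g. Q (fst g)} \<longleftrightarrow> Q (fst g)"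
proof
  assume "g <#\<^bsub>nilG\<^esub> \<Gamma> \<in> (\<lambda>g. g <#\<^bsub>nilG\<^esub> \<Gamma>) ` {g. Q (fst g)}"
  then obtain h where h: "Q (fst h)" "g <#\<^bsub>nilG\<^esub> \<Gamma> = h <#\<^bsub>nilG\<^esub> \<Gamma>" by blast
  from coset_eq_fst[OF assms(1) h(2)[symmetric]]
  obtain l where "l \<in> fst ` \<Gamma>" "fst h = fst g + l" .
  then show "Q (fst g)" using Q[of l "fst g"] h(1) by simp
qed blast

lemma openin_coset_set:
  assumes "subgroup \<Gamma> nilG" "\<And>v l. l \<in> fst ` \<Gamma> \<Longrightarrow> Q (v + l) \<Longrightarrow> Q v" "open {v. Q v}"
  shows "openin (coset_topology \<Gamma>) ((\<lambda>g. g <#\<^bsub>nilG\<^esub> \<Gamma>) ` {g. Q (fst g)})"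
proof -
  have "open (fst -` {v. Q v} :: lie set)"
    using assms(3) by (rule open_vimage_fst)
  moreover have "{g. g <#\<^bsub>nilG\<^esub> \<Gamma> \<in> (\<lambda>g. g <#\<^bsub>nilG\<^esub> \<Gamma>) ` {g. Q (fst g)}} = fst -` {v. Q v}"
    using vimage_coset_set[OF assms(1), of Q] assms(2) by auto
  moreover have "(\<lambda>g. g <#\<^bsub>nilG\<^esub> \<Gamma>) ` {g. Q (fst g)} \<subseteq> lcosets\<^bsub>nilG\<^esub> \<Gamma>"
    using coset_in_lcosets by blast
  ultimately show ?thesis unfolding openin_coset_topology by simp
qed

lemma lcosets_nilG: "lcosets\<^bsub>nilG\<^esub> \<Gamma> = range (\<lambda>g. g <#\<^bsub>nilG\<^esub> \<Gamma>)"
  by (auto simp: LCOSETS_def)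

text \<open>If \<open>a\<close> were orthogonal to the projection, the absolute value of
  \<open>a \<bullet> fst g\<close> would descend to an unbounded function on the compact quotient;
  its open sublevel sets \<open>U n\<close> would have no finite subcover.\<close>

lemma span_fst_lattice:
  assumes "is_lattice \<Gamma>"
  shows "span (fst ` \<Gamma>) = UNIV"
proof (rule ccontr)
  have sub: "subgroup \<Gamma> nilG" and cpt: "compact_space (coset_topology \<Gamma>)"
    using assms by (simp_all add: is_lattice_def)
  assume "span (fst ` \<Gamma>) \<noteq> UNIV"
  then obtain a where a: "a \<noteq> 0" "\<And>x. x \<in> span (fst ` \<Gamma>) \<Longrightarrow> a \<bullet> x = 0"
    using span_not_UNIV_orthogonal[of "fst ` \<Gamma>"] by blast
  define U where "U n = (\<lambda>g. g <#\<^bsub>nilG\<^esub> \<Gamma>) ` {g. \<bar>a \<bullet> fst g\<bar> < real n}" for n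
  have Q: "\<bar>a \<bullet> v\<bar> < real n" if "l \<in> fst ` \<Gamma>" "\<bar>a \<bullet> (v + l)\<bar> < real n" for v l n
    using that a(2)[of l] by (simp add: inner_add_right span_base)
  have "open {v. \<bar>a \<bullet> v\<bar> < real n}" for n
    by (intro open_Collect_less continuous_intros)
  then have "openin (coset_topology \<Gamma>) (U n)" for n
    unfolding U_def using openin_coset_set[OF sub, of "\<lambda>v. \<bar>a \<bullet> v\<bar> < real n"] Q by blast
  moreover have "lcosets\<^bsub>nilG\<^esub> \<Gamma> \<subseteq> \<Union> (range U)"
  proof
    fix C assume "C \<in> lcosets\<^bsub>nilG\<^esub> \<Gamma>"
    then obtain g where g: "C = g <#\<^bsub>nilG\<^esub> \<Gamma>" by (auto simp: lcosets_nilG)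
    obtain n where "\<bar>a \<bullet> fst g\<bar> < real n" using reals_Archimedean2 by blast
    then show "C \<in> \<Union> (range U)" unfolding g U_def by blast
  qed
  ultimately obtain F where F: "finite F" "F \<subseteq> range U" "lcosets\<^bsub>nilG\<^esub> \<Gamma> \<subseteq> \<Union>F"
    using cpt[unfolded compact_space_alt topspace_coset_topology, rule_format, of "range U"] by blast
  then obtain I where I: "finite I" "F = U ` I" using finite_subset_image[of F U UNIV] by blast
  obtain N where N: "\<And>n. n \<in> I \<Longrightarrow> n \<le> N" using Max_ge[OF I(1)] by blast
  \<comment> \<open>Scaled so that \<open>a \<bullet> fst g\<close> is \<open>N\<close>, which lies
    outside every selected slab.\<close>
  define g :: lie where "g = ((real N / (a \<bullet> a)) *\<^sub>R a, 0)"
  have ag: "a \<bullet> fst g = real N" using a(1) by (simp add: g_def)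
  have "g <#\<^bsub>nilG\<^esub> \<Gamma> \<in> \<Union>F" using F(3) coset_in_lcosets by blast
  then obtain n where n: "n \<in> I" "g <#\<^bsub>nilG\<^esub> \<Gamma> \<in> U n" using I(2) by blast
  then have "\<bar>a \<bullet> fst g\<bar> < real n"
    using vimage_coset_set[OF sub, where Q="\<lambda>v. \<bar>a \<bullet> v\<bar> < real n", OF Q] by (simp add: U_def)
  then show False using N[OF n(1)] ag by simp
qed

text \<open>Elements of \<open>W\<close> vanish at the entries (1,2), (1,3) and (4,5); wedging
  \<open>v\<close> with suitable basis vectors places each coordinate of \<open>v\<close>, up to
  sign, at one of these.\<close>

lemma wedge_W_imp_0:
  assumes "\<And>w. v \<^bold>\<and> w \<in> W"
  shows "v = 0"
proof -
  have "(v \<^bold>\<and> \<sigma> i) $ j $ k = 0" if "(j, k) \<in> {(1, 2), (1, 3), (4, 5)}" for i j k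
  proof -
    obtain x where "v \<^bold>\<and> \<sigma> i = wcomb x" using assms W_eq_range by blast
    then show ?thesis using that by (auto simp: wcomb_nth)
  qed
  from this[of 1 2 2] this[of 1 2 1] this[of 1 3 1] this[of 4 5 5] this[of 4 5 4]
  show ?thesis by (simp add: vec_eq_iff forall_5 wedge_def axis_def)
qed

text \<open>For small \<open>v\<close> the commutators with a fixed basis from the projection lie in
  the lattice near 0, so they vanish. Then \<open>v\<close> commutes with all of \<open>V\<close>,
  which forces \<open>v = 0\<close>.\<close>

lemma discrete_fst_lattice:
  assumes "is_lattice \<Gamma>"
  obtains e where "e > 0" "\<And>v. v \<in> fst ` \<Gamma> \<Longrightarrow> norm v < e \<Longrightarrow> v = 0"
proof -
  have sub: "subgroup \<Gamma> nilG" and "discrete \<Gamma>"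
    using assms by (simp_all add: is_lattice_def)
  have "0 \<in> \<Gamma>" using subgroup.one_closed[OF sub] by simp
  then have "0 isolated_in \<Gamma>" using \<open>discrete \<Gamma>\<close> by (simp add: discrete_def)
  then obtain T where T: "open T" "T \<inter> \<Gamma> = {0}" unfolding isolated_in_def by blast
  obtain B where B: "B \<subseteq> fst ` \<Gamma>" "independent B" "fst ` \<Gamma> \<subseteq> span B"
    using maximal_independent_subset by blast
  have spanB: "span B = UNIV"
    using span_fst_lattice[OF assms] span_mono[OF B(3)] by (simp only: span_span) blast
  have "eventually (\<lambda>v. bracket (v, 0) (b, 0) \<in> T) (nhds 0)" for b
  proof -
    have "linear (\<lambda>v. bracket (v, 0) (b, 0))"
      by (rule linearI) (simp_all add: bracket_def wedge_add wedge_scaleR modW_add modW_scaleR)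
    then have "continuous_on UNIV (\<lambda>v. bracket (v, 0) (b, 0))"
      by (simp add: linear_continuous_on linear_conv_bounded_linear)
    then have "open ((\<lambda>v. bracket (v, 0) (b, 0)) -` T)"
      using T(1) by (simp add: open_vimage)
    moreover have "bracket (0, 0) (b, 0) \<in> T" using T(2) by (auto simp: bracket_central)
    ultimately show ?thesis by (auto simp: eventually_nhds)
  qed
  then have "eventually (\<lambda>v. \<forall>b\<in>B. bracket (v, 0) (b, 0) \<in> T) (nhds 0)"
    using independent_imp_finite[OF B(2)] by (simp add: eventually_ball_finite)
  then obtain e where e: "e > 0" "\<And>v b. norm v < e \<Longrightarrow> b \<in> B \<Longrightarrow> bracket (v, 0) (b, 0) \<in> T"
    unfolding eventually_nhds_metric by (auto simp: dist_norm)
  show ?thesis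
  proof (rule that[OF e(1)])
    fix v assume v: "v \<in> fst ` \<Gamma>" "norm v < e"
    have W: "v \<^bold>\<and> b \<in> W" if "b \<in> B" for b
    proof -
      \<comment> \<open>The lifts may be far from 0, but their bracket depends only on the
        projections.\<close>
      obtain x y where xy: "x \<in> \<Gamma>" "y \<in> \<Gamma>" "fst x = v" "fst y = b"
        using v(1) subsetD[OF B(1) \<open>b \<in> B\<close>] by (metis imageE)
      have "bracket x y = bracket (v, 0) (b, 0)" by (simp add: bracket_def xy)
      moreover have "bracket x y \<in> \<Gamma>"
        unfolding commutator_nilG[symmetric] using xy sub
        by (intro subgroup.m_closed subgroup.m_inv_closed)
      ultimately have "bracket (v, 0) (b, 0) = 0" using e(2)[OF v(2) that] T(2) by auto
      then show ?thesis
        using modW_eq_iff[OF wedge_in_Wedge2 subspace_0[OF subspace_Wedge2]]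
        by (simp add: bracket_def modW_0 zero_prod_def)
    qed
    have "subspace {w. v \<^bold>\<and> w \<in> W}"
      using subspace_W by (simp add: subspace_def wedge_add wedge_scaleR)
    then have "span B \<subseteq> {w. v \<^bold>\<and> w \<in> W}" using W by (intro span_minimal) auto
    then show "v = 0" using spanB by (intro wedge_W_imp_0) auto
  qed
qed

lemma lattice_coordinates_fst:
  assumes "is_lattice \<Gamma>"
  obtains \<phi> P m where "lattice_coordinates (fst ` \<Gamma>) \<phi> P m"
proof -
  have sub: "subgroup \<Gamma> nilG" using assms by (simp add: is_lattice_def)
  obtain e where "e > 0" "\<And>v. v \<in> fst ` \<Gamma> \<Longrightarrow> norm v < e \<Longrightarrow> v = 0"
    using discrete_fst_lattice[OF assms] by blast
  with fst_subgroup_diff[OF sub] show ?thesis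
    by (rule lattice_coordinates_exist[OF _ _ _ span_fst_lattice[OF assms] that])
qed

lemma factor_image_lattice:
  assumes "\<tau> \<in> Aut" "\<tau> ` \<Gamma> = \<Gamma>"
  shows "factor \<tau> ` fst ` \<Gamma> = fst ` \<Gamma>"
proof -
  have "factor \<tau> ` fst ` \<Gamma> = fst ` \<tau> ` \<Gamma>" by (simp add: image_image factor_fst[OF assms(1)])
  then show ?thesis by (simp add: assms(2))
qed

lemma lattice_eigenvalue:
  assumes "is_lattice \<Gamma>" "\<tau> \<in> Aut" "\<tau> ` \<Gamma> = \<Gamma>"
  obtains v c where "v \<noteq> 0" "factor \<tau> v = of_int c *\<^sub>R v" "c = 1 \<or> c = -1"
proof -
  obtain \<phi> P m where "lattice_coordinates (fst ` \<Gamma>) \<phi> P m"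
    using lattice_coordinates_fst[OF assms(1)] by blast
  then have "\<bar>det (matrix (factor \<tau>))\<bar> = 1"
    by (rule lattice_coordinates.abs_det_eq_1) (use assms linear_factor factor_image_lattice in auto)
  then show ?thesis using factor_eigenvalue[OF assms(2)] that by blast
qed

section \<open>An invariant set of intermediate measure\<close>

lemma shift_coset_set:
  assumes "subgroup \<Gamma> nilG"
  shows "(\<lambda>C. h <#\<^bsub>nilG\<^esub> C) ` (\<lambda>g. g <#\<^bsub>nilG\<^esub> \<Gamma>) ` {g. Q (fst g)} =
    (\<lambda>g. g <#\<^bsub>nilG\<^esub> \<Gamma>) ` {g. Q (fst g - fst h)}"
proof -
  have \<Gamma>: "\<Gamma> \<subseteq> carrier nilG" by simp
  have m: "h <#\<^bsub>nilG\<^esub> (g <#\<^bsub>nilG\<^esub> \<Gamma>) = (h \<otimes>\<^bsub>nilG\<^esub> g) <#\<^bsub>nilG\<^esub> \<Gamma>" for g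
    using nilG.lcos_m_assoc[OF \<Gamma>, of h g] by (simp del: nilG_simps(2))
  have "{g. Q (fst g - fst h)} = (\<lambda>g. h \<otimes>\<^bsub>nilG\<^esub> g) ` {g. Q (fst g)}"
  proof (intro equalityI subsetI)
    fix g :: lie assume "g \<in> {g. Q (fst g - fst h)}"
    moreover have "g = h \<otimes>\<^bsub>nilG\<^esub> (inv\<^bsub>nilG\<^esub> h \<otimes>\<^bsub>nilG\<^esub> g)"
      by (subst nilG.m_assoc[symmetric]) (simp_all add: nilG.r_inv nilG.l_one del: nilG_simps(2))
    moreover have "fst (inv\<^bsub>nilG\<^esub> h \<otimes>\<^bsub>nilG\<^esub> g) = fst g - fst h" by (simp add: inv_nilG)
    ultimately show "g \<in> (\<lambda>g. h \<otimes>\<^bsub>nilG\<^esub> g) ` {g. Q (fst g)}"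
      by (intro image_eqI[of _ _ "inv\<^bsub>nilG\<^esub> h \<otimes>\<^bsub>nilG\<^esub> g"]) (simp_all del: nilG_simps(2))
  qed auto
  then show ?thesis by (simp only: image_image m)
qed

text \<open>The covector \<open>\<xi>\<close> induces a map from the quotient to the circle of reals
  modulo 1, and \<open>E s\<close> is the preimage of the open arc of radius 1/4 about
  \<open>s\<close>. The arc about 0 is invariant under negation, so \<open>E 0\<close> is invariant
  under the induced map.\<close>

lemma not_ergodic:
  assumes lat: "is_lattice \<Gamma>" and \<tau>: "\<tau> \<in> Aut" "\<tau> ` \<Gamma> = \<Gamma>" and \<mu>: "invariant_prob \<Gamma> \<mu>"
  shows "\<not> ergodic \<mu> (induced \<Gamma> \<tau>)"
proof -
  have sub: "subgroup \<Gamma> nilG" using lat by (simp add: is_lattice_def)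
  interpret prob_space \<mu> using \<mu> by (simp add: invariant_prob_def)
  have space: "space \<mu> = lcosets\<^bsub>nilG\<^esub> \<Gamma>"
    and sets: "sets \<mu> = sigma_sets (lcosets\<^bsub>nilG\<^esub> \<Gamma>) {U. openin (coset_topology \<Gamma>) U}"
    and inv: "\<And>g A. A \<in> sets \<mu> \<Longrightarrow> emeasure \<mu> ((\<lambda>C. g <#\<^bsub>nilG\<^esub> C) ` A) = emeasure \<mu> A"
    using \<mu> by (auto simp: invariant_prob_def)
  obtain \<phi> P m where "lattice_coordinates (fst ` \<Gamma>) \<phi> P m"
    using lattice_coordinates_fst[OF lat] by blast
  moreover obtain v c where v: "v \<noteq> 0" "factor \<tau> v = of_int c *\<^sub>R v" and c: "c = 1 \<or> c = -1"
    using lattice_eigenvalue[OF lat \<tau>] by metis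
  ultimately obtain \<xi> where \<xi>: "\<xi> \<noteq> 0" "\<And>l. l \<in> fst ` \<Gamma> \<Longrightarrow> \<xi> \<bullet> l \<in> \<int>"
    "\<And>x. \<xi> \<bullet> factor \<tau> x = of_int c * (\<xi> \<bullet> x)"
    using lattice_coordinates.rational_invariant_covector[of "fst ` \<Gamma>" \<phi> P m "factor \<tau>"]
      linear_factor[OF \<tau>(1)] factor_image_lattice[OF \<tau>] by (metis subset_refl)
  define Q where "Q s v \<longleftrightarrow> (\<exists>k::int. \<bar>\<xi> \<bullet> v - s - of_int k\<bar> < 1/4)" for s v
  define E where "E s = (\<lambda>g. g <#\<^bsub>nilG\<^esub> \<Gamma>) ` {g. Q s (fst g)}" for s
  have Q_period: "Q s v" if l: "l \<in> fst ` \<Gamma>" and Q: "Q s (v + l)" for s v l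
  proof -
    obtain j where j: "\<xi> \<bullet> l = of_int j" using \<xi>(2)[OF l] by (auto elim: Ints_cases)
    obtain k :: int where "\<bar>\<xi> \<bullet> (v + l) - s - of_int k\<bar> < 1/4" using Q by (auto simp: Q_def)
    then have "\<bar>\<xi> \<bullet> v - s - of_int (k - j)\<bar> < 1/4" by (simp add: inner_add_right j algebra_simps)
    then show ?thesis unfolding Q_def by blast
  qed
  have mem_E: "g <#\<^bsub>nilG\<^esub> \<Gamma> \<in> E s \<longleftrightarrow> Q s (fst g)" for g s
    unfolding E_def using Q_period by (rule vimage_coset_set[OF sub])
  have "{v. Q s v} = (\<Union>k::int. {v. \<bar>\<xi> \<bullet> v - s - of_int k\<bar> < 1/4})" for s
    by (auto simp: Q_def)
  moreover have "open {v. \<bar>\<xi> \<bullet> v - s - of_int k\<bar> < 1/4}" for s k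
    by (intro open_Collect_less continuous_intros)
  ultimately have open_Q: "open {v. Q s v}" for s by (simp add: open_UN)
  have "openin (coset_topology \<Gamma>) (E s)" for s
    unfolding E_def using openin_coset_set[OF sub, of "Q s"] Q_period open_Q by blast
  then have E_sets: "E s \<in> sets \<mu>" for s
    unfolding sets by (intro sigma_sets.Basic) simp
  have E_shift: "measure \<mu> (E s) = measure \<mu> (E 0)" for s
  proof -
    \<comment> \<open>Translation by \<open>h\<close> rotates the circle by \<open>s\<close>, so all
      \<open>E s\<close> have equal measure.\<close>
    define h :: lie where "h = ((s / (\<xi> \<bullet> \<xi>)) *\<^sub>R \<xi>, 0)"
    have h: "\<xi> \<bullet> fst h = s" using \<xi>(1) by (simp add: h_def)
    have "E s = (\<lambda>C. h <#\<^bsub>nilG\<^esub> C) ` E 0"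
      unfolding E_def shift_coset_set[OF sub] by (simp add: Q_def inner_diff_right h)
    then show ?thesis using inv[OF E_sets] by (simp add: measure_def)
  qed
  \<comment> \<open>Two disjoint translates bound the measure of \<open>E 0\<close> by 1/2.\<close>
  have "E 0 \<inter> E (1/2) = {}"
  proof -
    have False if "Q 0 v" "Q (1/2) v" for v
    proof -
      from that obtain j k :: int where "\<bar>\<xi> \<bullet> v - of_int j\<bar> < 1/4" "\<bar>\<xi> \<bullet> v - 1/2 - of_int k\<bar> < 1/4"
        by (auto simp: Q_def)
      then have "\<bar>2 * real_of_int j - 2 * of_int k - 1\<bar> < 1" by linarith
      then have "\<bar>2 * j - 2 * k - 1\<bar> < 1" by linarith
      then show False by presburger
    qed
    then show ?thesis using mem_E by (fastforce simp: E_def)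
  qed
  then have "measure \<mu> (E 0) + measure \<mu> (E (1/2)) \<le> 1"
    using finite_measure_Union[OF E_sets E_sets] prob_le_1 by metis
  then have not_1: "measure \<mu> (E 0) \<noteq> 1" using E_shift[of "1/2"] by linarith
  \<comment> \<open>Opposite open arcs miss their common endpoints, so four arcs are used to cover
    the circle; this bounds the measure of \<open>E 0\<close> below by 1/4.\<close>
  have "space \<mu> \<subseteq> (E 0 \<union> E (1/4)) \<union> (E (1/2) \<union> E (3/4))"
  proof
    fix C assume "C \<in> space \<mu>"
    then obtain g where g: "C = g <#\<^bsub>nilG\<^esub> \<Gamma>" unfolding space lcosets_nilG by blast
    let ?t = "\<xi> \<bullet> fst g"
    let ?k = "\<lfloor>4 * ?t\<rfloor>"
    have "?k = 4 * (?k div 4) + ?k mod 4" by simp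
    then have "real_of_int ?k = 4 * of_int (?k div 4) + of_int (?k mod 4)" by linarith
    moreover have "of_int ?k \<le> 4 * ?t" "4 * ?t < of_int ?k + 1" by linarith+
    ultimately have "\<bar>?t - of_int (?k mod 4) / 4 - of_int (?k div 4)\<bar> < 1/4" by linarith
    then have "Q (of_int (?k mod 4) / 4) (fst g)" unfolding Q_def by blast
    moreover have "?k mod 4 = 0 \<or> ?k mod 4 = 1 \<or> ?k mod 4 = 2 \<or> ?k mod 4 = 3" by presburger
    ultimately show "C \<in> (E 0 \<union> E (1/4)) \<union> (E (1/2) \<union> E (3/4))" by (auto simp: g mem_E)
  qed
  then have "1 \<le> measure \<mu> ((E 0 \<union> E (1/4)) \<union> (E (1/2) \<union> E (3/4)))"
    using finite_measure_mono[of "space \<mu>"] E_sets prob_space by (metis sets.Un)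
  also have "\<dots> \<le> (measure \<mu> (E 0) + measure \<mu> (E (1/4))) + (measure \<mu> (E (1/2)) + measure \<mu> (E (3/4)))"
    by (intro order_trans[OF measure_Un_le] add_mono measure_Un_le sets.Un E_sets)
  finally have not_0: "measure \<mu> (E 0) \<noteq> 0"
    using E_shift[of "1/4"] E_shift[of "1/2"] E_shift[of "3/4"] by linarith
  have "Q 0 (fst (\<tau> g)) \<longleftrightarrow> Q 0 (fst g)" for g
  proof -
    have neg: "(\<exists>k::int. \<bar>- t - of_int k\<bar> < 1/4) \<longleftrightarrow> (\<exists>k::int. \<bar>t - of_int k\<bar> < 1/4)" for t :: real
    proof -
      have "\<bar>- t - of_int k\<bar> = \<bar>t - of_int (- k)\<bar>" for k by simp
      then show ?thesis by (metis minus_minus)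
    qed
    show ?thesis
      using c neg[of "\<xi> \<bullet> fst g"] by (elim disjE) (simp_all add: Q_def factor_fst[OF \<tau>(1)] \<xi>(3))
  qed
  then have "induced \<Gamma> \<tau> -` E 0 \<inter> space \<mu> = E 0"
  proof -
    assume inv_Q: "\<And>g. Q 0 (fst (\<tau> g)) \<longleftrightarrow> Q 0 (fst g)"
    have "C \<in> induced \<Gamma> \<tau> -` E 0 \<inter> space \<mu> \<longleftrightarrow> C \<in> E 0" for C
    proof (cases "C \<in> lcosets\<^bsub>nilG\<^esub> \<Gamma>")
      case True
      then obtain g where "C = g <#\<^bsub>nilG\<^esub> \<Gamma>" by (auto simp: lcosets_nilG)
      then show ?thesis
        using inv_Q[of g] coset_in_lcosets[of g \<Gamma>] by (simp add: space induced_coset[OF \<tau>] mem_E)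
    next
      case False
      moreover have "E 0 \<subseteq> lcosets\<^bsub>nilG\<^esub> \<Gamma>" using coset_in_lcosets by (auto simp: E_def)
      ultimately show ?thesis by (auto simp: space)
    qed
    then show ?thesis by blast
  qed
  then show ?thesis
    using E_sets[of 0] not_0 not_1 unfolding ergodic_def by blast
qed

theorem corollary6p1:
  shows "(\<forall>\<tau>\<in>Aut. det (matrix (factor \<tau>)) = 1 \<longrightarrow> (\<exists>v. v \<noteq> 0 \<and> factor \<tau> v = v)) \<and>
    (\<forall>\<Gamma> \<tau>. is_lattice \<Gamma> \<and> \<tau> \<in> Aut \<and> \<tau> ` \<Gamma> = \<Gamma> \<longrightarrow>
       \<not> anosov_automorphism \<Gamma> (induced \<Gamma> \<tau>) \<and>
       (\<forall>\<mu>. invariant_prob \<Gamma> \<mu> \<longrightarrow> \<not> ergodic \<mu> (induced \<Gamma> \<tau>)))"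
proof (intro conjI ballI allI impI)
  show "\<exists>v. v \<noteq> 0 \<and> factor \<tau> v = v" if "\<tau> \<in> Aut" "det (matrix (factor \<tau>)) = 1" for \<tau>
    using factor_fixed_point[OF that] by blast
next
  fix \<Gamma> \<tau> assume *: "is_lattice \<Gamma> \<and> \<tau> \<in> Aut \<and> \<tau> ` \<Gamma> = \<Gamma>"
  then show "\<not> ergodic \<mu> (induced \<Gamma> \<tau>)" if "invariant_prob \<Gamma> \<mu>" for \<mu>
    using not_ergodic that by blast
  show "\<not> anosov_automorphism \<Gamma> (induced \<Gamma> \<tau>)"
  proof
    assume "anosov_automorphism \<Gamma> (induced \<Gamma> \<tau>)"
    \<comment> \<open>The hyperbolic automorphism \<open>\<rho>\<close> inducing the given map may
      differ from \<open>\<tau>\<close>, so the eigenvalue is obtained for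
      \<open>\<rho>\<close>.\<close>
    then obtain \<rho> where \<rho>: "\<rho> \<in> Aut" "\<rho> ` \<Gamma> = \<Gamma>" "hyperbolic \<rho>"
      unfolding anosov_automorphism_def using Aut_frechet_derivative by metis
    from * obtain v c where "v \<noteq> 0" "factor \<rho> v = of_int c *\<^sub>R v" "c = 1 \<or> c = -1"
      using lattice_eigenvalue[OF _ \<rho>(1,2)] by metis
    then show False using not_hyperbolic \<rho>(1,3) by blast
  qed
qed

end
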